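(* Let $p$ be a prime, $\alpha>1$, $0\le\beta<1$, $\gamma\ge0$, and $a_n\in\mathbb{R}$ ($n\ge0$). Let $f:\mathbb{Q}_p\to[0,\infty)$ be locally integrable and satisfy $$f(x)\sim|x|_p^{-\beta}\sum_{n=0}^\infty a_n(\log|x|_p)^{\gamma-n},\qquad|x|_p\to\infty,$$ i.e. for every $N\ge0$, $f(x)-|x|_p^{-\beta}\sum_{n=0}^N a_n(\log|x|_p)^{\gamma-n}=o\bigl(|x|_p^{-\beta}(\log|x|_p)^{\gamma-N}\bigr)$ as $|x|_p\to\infty$. Then $$(I^\alpha f)(x)\sim\frac{1-p^{-\alpha}}{1-p^{\alpha-1}}|x|_p^{\alpha-\beta}\sum_{n=0}^\infty B_n(\log|x|_p)^{\gamma-n},\qquad|x|_p\to\infty,$$ i.e. for every $N\ge0$, $(I^\alpha f)(x)-\frac{1-p^{-\alpha}}{1-p^{\alpha-1}}|x|_p^{\alpha-\beta}\sum_{n=0}^N B_n(\log|x|_p)^{\gamma-n}=o\bigl(|x|_p^{\alpha-\beta}(\log|x|_p)^{\gamma-N}\bigr)$, where $$B_n=\sum_{k=0}^n a_{n-k}\binom{\gamma+k-n}{k}\Omega(k,\alpha,\beta),\qquad \Omega(k,\alpha,\beta)=\int_{|t|_p\le1}\bigl(|1-t|_p^{\alpha-1}-|t|_p^{\alpha-1}\bigr)|t|_p^{-\beta}(\log|t|_p)^k\,dt.$$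
   Context: $\mathbb{Q}_p$ is the field of $p$-adic numbers with the $p$-adic absolute value $|\cdot|_p$; $dy$ is the Haar measure on $\mathbb{Q}_p$ normalized so that $\int_{|y|_p\le1}dy=1$; $\log$ is the natural logarithm. For real $c$ and $k\in\mathbb{N}$, $\binom{c}{k}=\frac{c(c-1)\cdots(c-k+1)}{k!}$, and $\binom{c}{0}=1$. For $\alpha>1$ and locally integrable $f$, the $p$-adic fractional integration operator is $$(I^\alpha f)(x)=\frac{1-p^{-\alpha}}{1-p^{\alpha-1}}\int_{|y|_p\le|x|_p}\bigl(|x-y|_p^{\alpha-1}-|y|_p^{\alpha-1}\bigr)f(y)\,dy.$$ *)

theory Defs
  imports "HOL-Analysis.Analysis" "HOL-Library.Landau_Symbols"
begin

section \<open>The p-adic absolute value on the rational numbers\<close>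

definition padic_abs_rat :: "nat \<Rightarrow> rat \<Rightarrow> real" where
  "padic_abs_rat p q =
     (if q = 0 then 0
      else real p powi (int (multiplicity (int p) (snd (quotient_of q)))
                        - int (multiplicity (int p) (fst (quotient_of q)))))"

lemma padic_abs_rat_Fract:
  assumes p: "prime p" and "a \<noteq> 0" "b \<noteq> 0"
  shows "padic_abs_rat p (Fract a b) =
    real p powi (int (multiplicity (int p) b) - int (multiplicity (int p) a))"
proof -
  obtain c d where cd: "quotient_of (Fract a b) = (c, d)" by (cases "quotient_of (Fract a b)")
  have d: "d > 0" using cd by (rule quotient_of_denom_pos)
  have q: "Fract a b = Fract c d" using cd by (simp add: Fract_of_int_quotient quotient_of_div)
  hence eq: "a * d = c * b" using d assms by (simp add: eq_rat)
  hence c: "c \<noteq> 0" using assms d by auto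
  have pe: "prime_elem (int p)" using p by simp
  have "multiplicity (int p) a + multiplicity (int p) d =
        multiplicity (int p) c + multiplicity (int p) b"
    using prime_elem_multiplicity_mult_distrib[OF pe \<open>a \<noteq> 0\<close>, of d]
          prime_elem_multiplicity_mult_distrib[OF pe c \<open>b \<noteq> 0\<close>] eq d by simp
  hence "int (multiplicity (int p) d) - int (multiplicity (int p) c) =
         int (multiplicity (int p) b) - int (multiplicity (int p) a)" by linarith
  moreover have "Fract a b \<noteq> 0" using assms by (simp add: Zero_rat_def eq_rat)
  ultimately show ?thesis unfolding padic_abs_rat_def cd by simp
qed

context
  fixes p :: nat
  assumes p: "prime p"
begin

lemma padic_abs_rat_0 [simp]: "padic_abs_rat p 0 = 0"
  by (simp add: padic_abs_rat_def)

lemma padic_abs_rat_1 [simp]: "padic_abs_rat p 1 = 1"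
  by (simp add: padic_abs_rat_def)

lemma padic_abs_rat_pos: "q \<noteq> 0 \<Longrightarrow> padic_abs_rat p q > 0"
  using prime_gt_0_nat[OF p] by (simp add: padic_abs_rat_def)

lemma padic_abs_rat_nonneg [simp]: "padic_abs_rat p q \<ge> 0"
  by (cases "q = 0") (auto simp: less_imp_le padic_abs_rat_pos)

lemma padic_abs_rat_eq_0_iff [simp]: "padic_abs_rat p q = 0 \<longleftrightarrow> q = 0"
  by (metis less_irrefl padic_abs_rat_0 padic_abs_rat_pos)

lemma padic_abs_rat_mult:
  "padic_abs_rat p (q * r) = padic_abs_rat p q * padic_abs_rat p r"
proof (cases "q = 0 \<or> r = 0")
  case False
  obtain a b c d where q: "q = Fract a b" "b > 0" and r: "r = Fract c d" "d > 0"
    by (metis Rat_cases)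
  have nz: "a \<noteq> 0" "b \<noteq> 0" "c \<noteq> 0" "d \<noteq> 0"
    using False q r by (auto simp: Zero_rat_def eq_rat)
  have pe: "prime_elem (int p)" using p by simp
  have "real p \<noteq> 0" using prime_gt_0_nat[OF p] by simp
  thus ?thesis using nz
    by (simp add: q r padic_abs_rat_Fract[OF p] prime_elem_multiplicity_mult_distrib[OF pe]
        flip: power_int_add) (simp add: algebra_simps)
qed auto

lemma padic_abs_rat_minus [simp]: "padic_abs_rat p (- q) = padic_abs_rat p q"
proof -
  have "padic_abs_rat p (-1) = 1"
    by (simp add: padic_abs_rat_def multiplicity_unit_right)
  thus ?thesis using padic_abs_rat_mult[of "-1" q] by simp
qed

lemma padic_abs_rat_diff_commute: "padic_abs_rat p (q - r) = padic_abs_rat p (r - q)"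
  using padic_abs_rat_minus[of "q - r"] by simp

lemma padic_abs_rat_add_le:
  "padic_abs_rat p (q + r) \<le> max (padic_abs_rat p q) (padic_abs_rat p r)"
proof (cases "q = 0 \<or> r = 0 \<or> q + r = 0")
  case False
  obtain a b c d where q: "q = Fract a b" "b > 0" and r: "r = Fract c d" "d > 0"
    by (metis Rat_cases)
  have nz: "a \<noteq> 0" "b \<noteq> 0" "c \<noteq> 0" "d \<noteq> 0"
    using False q r by (auto simp: Zero_rat_def eq_rat)
  have qr: "q + r = Fract (a * d + c * b) (b * d)" using q r by simp
  have s: "a * d + c * b \<noteq> 0" using False nz unfolding qr by (auto simp: Zero_rat_def eq_rat)
  have pe: "prime_elem (int p)" and pu: "\<not> is_unit (int p)" using p by auto
  define m where "m = min (multiplicity (int p) (a * d)) (multiplicity (int p) (c * b))"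
  have "int p ^ m dvd a * d" "int p ^ m dvd c * b"
    by (simp_all add: m_def multiplicity_dvd')
  hence "m \<le> multiplicity (int p) (a * d + c * b)"
    using s pu by (intro multiplicity_geI) auto
  hence "multiplicity (int p) (a * d) \<le> multiplicity (int p) (a * d + c * b) \<or>
         multiplicity (int p) (c * b) \<le> multiplicity (int p) (a * d + c * b)"
    by (auto simp: m_def min_def split: if_splits)
  hence "int (multiplicity (int p) (b * d)) - int (multiplicity (int p) (a * d + c * b))
           \<le> int (multiplicity (int p) b) - int (multiplicity (int p) a) \<or>
         int (multiplicity (int p) (b * d)) - int (multiplicity (int p) (a * d + c * b))
           \<le> int (multiplicity (int p) d) - int (multiplicity (int p) c)"
    using nz by (auto simp: prime_elem_multiplicity_mult_distrib[OF pe])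
  moreover have "real p \<ge> 1" using prime_ge_1_nat[OF p] by simp
  ultimately have "padic_abs_rat p (q + r) \<le> padic_abs_rat p q
                 \<or> padic_abs_rat p (q + r) \<le> padic_abs_rat p r"
    unfolding qr unfolding q r using s nz
    by (auto simp: padic_abs_rat_Fract[OF p] intro: power_int_increasing)
  thus ?thesis by (auto simp: max_def)
qed (auto simp: add_eq_0_iff2)

lemma padic_abs_rat_triangle: "padic_abs_rat p (q + r) \<le> padic_abs_rat p q + padic_abs_rat p r"
  using padic_abs_rat_add_le[of q r] padic_abs_rat_nonneg[of q] padic_abs_rat_nonneg[of r] by linarith

lemma padic_abs_rat_diff_le:
  "padic_abs_rat p (q - r) \<le> padic_abs_rat p q + padic_abs_rat p r"
  using padic_abs_rat_triangle[of q "- r"] by simp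

lemma padic_abs_rat_abs_diff:
  "\<bar>padic_abs_rat p q - padic_abs_rat p r\<bar> \<le> padic_abs_rat p (q - r)"
  using padic_abs_rat_triangle[of "q - r" r] padic_abs_rat_triangle[of "r - q" q]
        padic_abs_rat_diff_commute[of q r] by simp

lemma padic_abs_rat_inverse: "padic_abs_rat p (inverse q) = inverse (padic_abs_rat p q)"
proof (cases "q = 0")
  case False
  thus ?thesis using padic_abs_rat_mult[of q "inverse q"]
    by (simp add: field_simps)
qed simp

end


section \<open>The field of p-adic numbers as the completion of the rational numbers\<close>

text \<open>
  The prime is the cardinality of a type of class \<open>prime_card\<close>; every prime is the
  cardinality of such a type. The type \<open>'p padic\<close> consists of the rational sequences that are
  Cauchy for the p-adic absolute value, modulo null sequences. The lemmas
  \<open>padic_norm_of_rat\<close> and \<open>closure_of_rat_padic\<close> together with the instances for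
  \<open>field_char_0\<close> and \<open>complete_space\<close> show that it is the completion of the rationals.

  The library function \<open>norm\<close> cannot be used here, since it is tied to real normed vector spaces.
\<close>

class prime_card = finite +
  assumes prime_card: "prime CARD('a)"

definition padic_Cauchy :: "nat \<Rightarrow> (nat \<Rightarrow> rat) \<Rightarrow> bool" where
  "padic_Cauchy p X \<longleftrightarrow> (\<forall>e>0. \<exists>k. \<forall>m\<ge>k. \<forall>n\<ge>k. padic_abs_rat p (X m - X n) < e)"

context
  fixes p :: nat
  assumes p: "prime p"
begin

lemma padic_Cauchy_const: "padic_Cauchy p (\<lambda>_. q)"
  by (simp add: padic_Cauchy_def p)

lemma padic_Cauchy_add:
  assumes "padic_Cauchy p X" "padic_Cauchy p Y"
  shows "padic_Cauchy p (\<lambda>n. X n + Y n)"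
  unfolding padic_Cauchy_def
proof (intro allI impI)
  fix e :: real assume e: "e > 0"
  obtain k where k: "\<forall>m\<ge>k. \<forall>n\<ge>k. padic_abs_rat p (X m - X n) < e"
    using assms e unfolding padic_Cauchy_def by blast
  obtain l where l: "\<forall>m\<ge>l. \<forall>n\<ge>l. padic_abs_rat p (Y m - Y n) < e"
    using assms e unfolding padic_Cauchy_def by blast
  have "padic_abs_rat p (X m + Y m - (X n + Y n)) < e" if "m \<ge> max k l" "n \<ge> max k l" for m n
    using padic_abs_rat_add_le[OF p, of "X m - X n" "Y m - Y n"]
      k[rule_format, of m n] l[rule_format, of m n] that
    by (simp add: algebra_simps)
  thus "\<exists>k. \<forall>m\<ge>k. \<forall>n\<ge>k. padic_abs_rat p (X m + Y m - (X n + Y n)) < e" by blast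
qed

lemma padic_Cauchy_uminus: "padic_Cauchy p X \<Longrightarrow> padic_Cauchy p (\<lambda>n. - X n)"
  unfolding padic_Cauchy_def
  by (simp add: padic_abs_rat_diff_commute[OF p])

lemma padic_Cauchy_diff:
  "padic_Cauchy p X \<Longrightarrow> padic_Cauchy p Y \<Longrightarrow> padic_Cauchy p (\<lambda>n. X n - Y n)"
  using padic_Cauchy_add[OF _ padic_Cauchy_uminus, of X Y] by simp

lemma padic_Cauchy_convergent:
  assumes "padic_Cauchy p X"
  shows "convergent (\<lambda>n. padic_abs_rat p (X n))"
proof -
  have "Cauchy (\<lambda>n. padic_abs_rat p (X n))"
    unfolding Cauchy_def dist_real_def
    using assms padic_abs_rat_abs_diff[OF p] unfolding padic_Cauchy_def
    by (meson order_le_less_trans)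
  thus ?thesis by (simp add: Cauchy_convergent_iff)
qed

lemma padic_Cauchy_bounded:
  assumes "padic_Cauchy p X"
  obtains B where "B > 0" "\<And>n. padic_abs_rat p (X n) \<le> B"
proof -
  have "Bseq (\<lambda>n. padic_abs_rat p (X n))"
    by (intro convergent_imp_Bseq padic_Cauchy_convergent assms)
  thus ?thesis using that unfolding Bseq_def by (auto simp: p)
qed

lemma padic_Cauchy_mult:
  assumes X: "padic_Cauchy p X" and Y: "padic_Cauchy p Y"
  shows "padic_Cauchy p (\<lambda>n. X n * Y n)"
  unfolding padic_Cauchy_def
proof (intro allI impI)
  fix e :: real assume e: "e > 0"
  obtain B where B: "B > 0" "\<And>n. padic_abs_rat p (X n) \<le> B" using padic_Cauchy_bounded[OF X] by blast
  obtain C where C: "C > 0" "\<And>n. padic_abs_rat p (Y n) \<le> C" using padic_Cauchy_bounded[OF Y] by blast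
  obtain k where k: "\<forall>m\<ge>k. \<forall>n\<ge>k. padic_abs_rat p (X m - X n) < e / C"
    using X e C(1) unfolding padic_Cauchy_def by (meson divide_pos_pos)
  obtain l where l: "\<forall>m\<ge>l. \<forall>n\<ge>l. padic_abs_rat p (Y m - Y n) < e / B"
    using Y e B(1) unfolding padic_Cauchy_def by (meson divide_pos_pos)
  have "padic_abs_rat p (X m * Y m - X n * Y n) < e" if "m \<ge> max k l" "n \<ge> max k l" for m n
  proof -
    have "padic_abs_rat p ((X m - X n) * Y m) < e"
      unfolding padic_abs_rat_mult[OF p]
      by (rule order_le_less_trans[OF mult_left_mono[OF C(2)]])
         (use k[rule_format, of m n] that C(1) in \<open>auto simp: p pos_less_divide_eq\<close>)
    moreover have "padic_abs_rat p (X n * (Y m - Y n)) < e"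
      unfolding padic_abs_rat_mult[OF p]
      by (rule order_le_less_trans[OF mult_right_mono[OF B(2)]])
         (use l[rule_format, of m n] that B(1) in \<open>auto simp: p pos_less_divide_eq mult.commute\<close>)
    moreover have "X m * Y m - X n * Y n = (X m - X n) * Y m + X n * (Y m - Y n)"
      by (simp add: algebra_simps)
    ultimately show ?thesis
      using padic_abs_rat_add_le[OF p, of "(X m - X n) * Y m" "X n * (Y m - Y n)"] by simp
  qed
  thus "\<exists>k. \<forall>m\<ge>k. \<forall>n\<ge>k. padic_abs_rat p (X m * Y m - X n * Y n) < e" by blast
qed

lemma padic_Cauchy_inverse:
  assumes X: "padic_Cauchy p X" and L: "(\<lambda>n. padic_abs_rat p (X n)) \<longlonglongrightarrow> L" "L > 0"
  shows "padic_Cauchy p (\<lambda>n. inverse (X n))"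
  unfolding padic_Cauchy_def
proof (intro allI impI)
  fix e :: real assume e: "e > 0"
  obtain k where k: "\<And>n. n \<ge> k \<Longrightarrow> padic_abs_rat p (X n) > L / 2"
    using order_tendstoD(1)[OF L(1), of "L / 2"] L(2) by (auto simp: eventually_sequentially)
  have "e * (L / 2 * (L / 2)) > 0" using e L(2) by simp
  then obtain l where
      l: "\<forall>m\<ge>l. \<forall>n\<ge>l. padic_abs_rat p (X m - X n) < e * (L / 2 * (L / 2))"
    using X unfolding padic_Cauchy_def by blast
  have "padic_abs_rat p (inverse (X m) - inverse (X n)) < e"
    if mn: "m \<ge> max k l" "n \<ge> max k l" for m n
  proof -
    have km: "padic_abs_rat p (X m) > L / 2" and kn: "padic_abs_rat p (X n) > L / 2"
      using k mn by auto
    hence nz: "X m \<noteq> 0" "X n \<noteq> 0" using L(2) by (auto simp: p)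
    hence "X n - X m = (inverse (X m) - inverse (X n)) * (X m * X n)"
      by (simp add: field_simps)
    hence "padic_abs_rat p (inverse (X m) - inverse (X n))
             * (padic_abs_rat p (X m) * padic_abs_rat p (X n)) < e * (L / 2 * (L / 2))"
      using l[rule_format, of n m] mn by (simp flip: padic_abs_rat_mult[OF p])
    also have "\<dots> \<le> e * (padic_abs_rat p (X m) * padic_abs_rat p (X n))"
      using e km kn L(2) by (intro mult_left_mono mult_mono) auto
    finally show ?thesis
      by (rule mult_right_less_imp_less) (simp add: p)
  qed
  thus "\<exists>k. \<forall>m\<ge>k. \<forall>n\<ge>k. padic_abs_rat p (inverse (X m) - inverse (X n)) < e" by blast
qed

end

typedef (overloaded) 'p padic_seq = "{X. padic_Cauchy CARD('p::prime_card) X}"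
  morphisms seq_of Padic_Seq
  using padic_Cauchy_const[OF prime_card] by blast

setup_lifting type_definition_padic_seq

instantiation padic_seq :: (prime_card) comm_ring_1
begin

lift_definition zero_padic_seq :: "'a padic_seq" is "\<lambda>_. 0"
  by (rule padic_Cauchy_const[OF prime_card])
lift_definition one_padic_seq :: "'a padic_seq" is "\<lambda>_. 1"
  by (rule padic_Cauchy_const[OF prime_card])
lift_definition plus_padic_seq :: "'a padic_seq \<Rightarrow> 'a padic_seq \<Rightarrow> 'a padic_seq"
  is "\<lambda>X Y n. X n + Y n" by (rule padic_Cauchy_add[OF prime_card])
lift_definition minus_padic_seq :: "'a padic_seq \<Rightarrow> 'a padic_seq \<Rightarrow> 'a padic_seq"
  is "\<lambda>X Y n. X n - Y n" by (rule padic_Cauchy_diff[OF prime_card])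
lift_definition uminus_padic_seq :: "'a padic_seq \<Rightarrow> 'a padic_seq"
  is "\<lambda>X n. - X n" by (rule padic_Cauchy_uminus[OF prime_card])
lift_definition times_padic_seq :: "'a padic_seq \<Rightarrow> 'a padic_seq \<Rightarrow> 'a padic_seq"
  is "\<lambda>X Y n. X n * Y n" by (rule padic_Cauchy_mult[OF prime_card])

instance
  by standard (transfer; simp add: algebra_simps fun_eq_iff)+

end

lift_definition padic_seq_abs :: "'p::prime_card padic_seq \<Rightarrow> real"
  is "\<lambda>X. lim (\<lambda>n. padic_abs_rat CARD('p) (X n))" .

lemma padic_seq_abs_LIMSEQ:
  "(\<lambda>n. padic_abs_rat CARD('p) (seq_of x n)) \<longlonglongrightarrow> padic_seq_abs (x :: 'p::prime_card padic_seq)"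
  by transfer (use padic_Cauchy_convergent[OF prime_card] in \<open>simp add: convergent_LIMSEQ_iff\<close>)

lemma padic_seq_abs_nonneg: "padic_seq_abs x \<ge> 0"
  by (rule LIMSEQ_le_const[OF padic_seq_abs_LIMSEQ]) (simp add: prime_card)

lemma padic_seq_abs_mult: "padic_seq_abs (x * y) = padic_seq_abs x * padic_seq_abs y"
proof (rule LIMSEQ_unique[OF padic_seq_abs_LIMSEQ])
  show "(\<lambda>n. padic_abs_rat CARD('a) (seq_of (x * y) n)) \<longlonglongrightarrow> padic_seq_abs x * padic_seq_abs y"
    unfolding times_padic_seq.rep_eq padic_abs_rat_mult[OF prime_card]
    by (intro tendsto_mult padic_seq_abs_LIMSEQ)
qed

lemma padic_seq_abs_add_le:
  "padic_seq_abs (x + y) \<le> max (padic_seq_abs x) (padic_seq_abs y)"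
proof (rule LIMSEQ_le[OF padic_seq_abs_LIMSEQ tendsto_max[OF padic_seq_abs_LIMSEQ padic_seq_abs_LIMSEQ]])
qed (simp add: plus_padic_seq.rep_eq padic_abs_rat_add_le[OF prime_card])

lemma padic_seq_abs_minus: "padic_seq_abs (- x) = padic_seq_abs x"
  by transfer (simp add: prime_card)

lemma padic_seq_abs_0: "padic_seq_abs 0 = 0"
  by transfer (simp add: prime_card)

lemma padic_seq_abs_1: "padic_seq_abs 1 = 1"
  by transfer (simp add: prime_card)

lemma padic_seq_abs_diff_commute: "padic_seq_abs (x - y) = padic_seq_abs (y - x)"
  using padic_seq_abs_minus[of "x - y"] by simp

lemma padic_seq_abs_add_null:
  assumes "padic_seq_abs x = 0" "padic_seq_abs y = 0"
  shows "padic_seq_abs (x + y) = 0"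
  using padic_seq_abs_add_le[of x y] padic_seq_abs_nonneg[of "x + y"] assms by simp

lemma padic_seq_abs_diff_null:
  assumes "padic_seq_abs (x - y) = 0"
  shows "padic_seq_abs x = padic_seq_abs y"
  using padic_seq_abs_add_le[of "x - y" y] padic_seq_abs_add_le[of "y - x" x] assms
    padic_seq_abs_nonneg[of x] padic_seq_abs_nonneg[of y]
    padic_seq_abs_diff_commute[of x y] by simp

lift_definition padic_seq_inverse :: "'p::prime_card padic_seq \<Rightarrow> 'p padic_seq"
  is "\<lambda>X. if lim (\<lambda>n. padic_abs_rat CARD('p) (X n)) = 0 then (\<lambda>_. 0) else (\<lambda>n. inverse (X n))"
proof -
  fix X :: "nat \<Rightarrow> rat" assume X: "padic_Cauchy CARD('p) X"
  let ?L = "lim (\<lambda>n. padic_abs_rat CARD('p) (X n))"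
  have L: "(\<lambda>n. padic_abs_rat CARD('p) (X n)) \<longlonglongrightarrow> ?L"
    using padic_Cauchy_convergent[OF prime_card X] by (simp add: convergent_LIMSEQ_iff)
  hence "?L \<ge> 0" by (rule LIMSEQ_le_const) (simp add: prime_card)
  thus "padic_Cauchy CARD('p) (if ?L = 0 then (\<lambda>_. 0) else (\<lambda>n. inverse (X n)))"
    using padic_Cauchy_inverse[OF prime_card X L] padic_Cauchy_const[OF prime_card] by auto
qed

lemma padic_seq_inverse_null:
  "padic_seq_abs x = 0 \<Longrightarrow> padic_seq_inverse x = 0"
  by transfer simp

lemma padic_seq_inverse_mult:
  fixes x :: "'p::prime_card padic_seq"
  assumes "padic_seq_abs x \<noteq> 0"
  shows "padic_seq_abs (padic_seq_inverse x * x - 1) = 0"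
proof (rule LIMSEQ_unique[OF padic_seq_abs_LIMSEQ])
  have pos: "padic_seq_abs x > 0" using assms padic_seq_abs_nonneg[of x] by simp
  have inv: "seq_of (padic_seq_inverse x) = (\<lambda>n. inverse (seq_of x n))"
    using assms by transfer simp
  have "eventually (\<lambda>n. padic_abs_rat CARD('p) (seq_of x n) > 0) sequentially"
    using order_tendstoD(1)[OF padic_seq_abs_LIMSEQ pos] .
  hence "eventually (\<lambda>n. padic_abs_rat CARD('p) (seq_of (padic_seq_inverse x * x - 1) n) = 0) sequentially"
  proof eventually_elim
    case (elim n)
    hence "seq_of x n \<noteq> 0" by (auto simp: prime_card)
    thus ?case
      by (simp add: minus_padic_seq.rep_eq times_padic_seq.rep_eq one_padic_seq.rep_eq inv prime_card)
  qed
  thus "(\<lambda>n. padic_abs_rat CARD('p) (seq_of (padic_seq_inverse x * x - 1) n)) \<longlonglongrightarrow> 0"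
    by (rule tendsto_eventually)
qed

definition padic_seq_rel :: "'p::prime_card padic_seq \<Rightarrow> 'p padic_seq \<Rightarrow> bool" where
  "padic_seq_rel x y \<longleftrightarrow> padic_seq_abs (x - y) = 0"

quotient_type 'p padic = "'p::prime_card padic_seq" / padic_seq_rel
  morphisms rep_padic Padic
proof (rule equivpI)
  show "reflp (padic_seq_rel :: 'p padic_seq \<Rightarrow> _)"
    by (auto simp: reflp_def padic_seq_rel_def padic_seq_abs_0)
  show "symp (padic_seq_rel :: 'p padic_seq \<Rightarrow> _)"
    by (auto simp: symp_def padic_seq_rel_def padic_seq_abs_diff_commute)
  show "transp (padic_seq_rel :: 'p padic_seq \<Rightarrow> _)"
  proof (rule transpI)
    fix x y z :: "'p padic_seq"
    assume "padic_seq_rel x y" "padic_seq_rel y z"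
    thus "padic_seq_rel x z"
      using padic_seq_abs_add_null[of "x - y" "y - z"] by (simp add: padic_seq_rel_def)
  qed
qed

instantiation padic :: (prime_card) field
begin

lift_definition zero_padic :: "'a padic" is 0 .
lift_definition one_padic :: "'a padic" is 1 .
lift_definition plus_padic :: "'a padic \<Rightarrow> 'a padic \<Rightarrow> 'a padic" is "(+)"
  unfolding padic_seq_rel_def add_diff_add by (rule padic_seq_abs_add_null)
lift_definition uminus_padic :: "'a padic \<Rightarrow> 'a padic" is uminus
  unfolding padic_seq_rel_def minus_diff_minus padic_seq_abs_minus .
lift_definition minus_padic :: "'a padic \<Rightarrow> 'a padic \<Rightarrow> 'a padic" is "(-)"
  unfolding padic_seq_rel_def diff_conv_add_uminus
proof -
  fix x x' y y' :: "'a padic_seq"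
  assume "padic_seq_abs (x + - x') = 0" "padic_seq_abs (y + - y') = 0"
  moreover have "x + - y + - (x' + - y') = (x + - x') + - (y + - y')" by simp
  ultimately show "padic_seq_abs (x + - y + - (x' + - y')) = 0"
    by (simp only: padic_seq_abs_add_null padic_seq_abs_minus)
qed
lift_definition times_padic :: "'a padic \<Rightarrow> 'a padic \<Rightarrow> 'a padic" is "(*)"
proof -
  fix x x' y y' :: "'a padic_seq"
  assume "padic_seq_rel x x'" "padic_seq_rel y y'"
  moreover have "x * y - x' * y' = (x - x') * y + x' * (y - y')" by (simp add: algebra_simps)
  ultimately show "padic_seq_rel (x * y) (x' * y')"
    by (simp add: padic_seq_rel_def padic_seq_abs_add_null padic_seq_abs_mult)
qed
lift_definition inverse_padic :: "'a padic \<Rightarrow> 'a padic" is padic_seq_inverse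
proof -
  fix x y :: "'a padic_seq"
  assume xy: "padic_seq_rel x y"
  hence eq: "padic_seq_abs x = padic_seq_abs y"
    unfolding padic_seq_rel_def by (rule padic_seq_abs_diff_null)
  show "padic_seq_rel (padic_seq_inverse x) (padic_seq_inverse y)"
  proof (cases "padic_seq_abs x = 0")
    case True
    thus ?thesis using eq by (simp add: padic_seq_inverse_null padic_seq_rel_def padic_seq_abs_0)
  next
    case False
    let ?u = "padic_seq_inverse x" and ?v = "padic_seq_inverse y"
    have "?u - ?v = ?u * ?v * (y - x) + (- (?v * (?u * 0))) + (?v * (?u * x - 1)) + (- (?u * (?v * y - 1)))"
      by (simp add: algebra_simps)
    moreover have "padic_seq_abs \<dots> = 0"
      using False eq xy padic_seq_inverse_mult[of x] padic_seq_inverse_mult[of y]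
      by (intro padic_seq_abs_add_null)
         (simp_all add: padic_seq_abs_mult padic_seq_rel_def padic_seq_abs_diff_commute[of y x]
            padic_seq_abs_minus padic_seq_abs_0)
    ultimately show ?thesis by (simp add: padic_seq_rel_def)
  qed
qed
definition divide_padic :: "'a padic \<Rightarrow> 'a padic \<Rightarrow> 'a padic" where
  "divide_padic x y = x * inverse y"

instance
proof
  fix a b c :: "'a padic"
  show "a * b * c = a * (b * c)"
    by transfer (simp add: padic_seq_rel_def padic_seq_abs_0 algebra_simps)
  show "a * b = b * a"
    by transfer (simp add: padic_seq_rel_def padic_seq_abs_0 algebra_simps)
  show "1 * a = a"
    by transfer (simp add: padic_seq_rel_def padic_seq_abs_0)
  show "a + b + c = a + (b + c)"
    by transfer (simp add: padic_seq_rel_def padic_seq_abs_0 algebra_simps)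
  show "a + b = b + a"
    by transfer (simp add: padic_seq_rel_def padic_seq_abs_0 algebra_simps)
  show "0 + a = a"
    by transfer (simp add: padic_seq_rel_def padic_seq_abs_0)
  show "- a + a = 0"
    by transfer (simp add: padic_seq_rel_def padic_seq_abs_0)
  show "a - b = a + - b"
    by transfer (simp add: padic_seq_rel_def padic_seq_abs_0)
  show "(a + b) * c = a * c + b * c"
    by transfer (simp add: padic_seq_rel_def padic_seq_abs_0 algebra_simps)
  show "(0 :: 'a padic) \<noteq> 1"
    by transfer (simp add: padic_seq_rel_def padic_seq_abs_1 padic_seq_abs_minus)
  show "a \<noteq> 0 \<Longrightarrow> inverse a * a = 1"
    by transfer (simp add: padic_seq_rel_def padic_seq_inverse_mult)
  show "a div b = a * inverse b" by (rule divide_padic_def)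
  show "inverse (0 :: 'a padic) = 0"
    by transfer (simp add: padic_seq_inverse_null padic_seq_abs_0 padic_seq_rel_def)
qed

end

lift_definition padic_norm :: "'p::prime_card padic \<Rightarrow> real" is padic_seq_abs
  unfolding padic_seq_rel_def by (rule padic_seq_abs_diff_null)

lemma padic_norm_nonneg: "padic_norm x \<ge> 0"
  by transfer (rule padic_seq_abs_nonneg)

lemma padic_norm_eq_0_iff: "padic_norm x = 0 \<longleftrightarrow> x = 0"
  by transfer (simp add: padic_seq_rel_def)

lemma padic_norm_one: "padic_norm 1 = 1"
  by transfer (rule padic_seq_abs_1)

lemma padic_norm_mult: "padic_norm (x * y) = padic_norm x * padic_norm y"
  by transfer (rule padic_seq_abs_mult)

lemma padic_norm_minus: "padic_norm (- x) = padic_norm x"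
  by transfer (rule padic_seq_abs_minus)

lemma padic_norm_add_le: "padic_norm (x + y) \<le> max (padic_norm x) (padic_norm y)"
  by transfer (rule padic_seq_abs_add_le)

instantiation padic :: (prime_card) metric_space
begin

definition dist_padic :: "'a padic \<Rightarrow> 'a padic \<Rightarrow> real" where
  "dist_padic x y = padic_norm (x - y)"
definition uniformity_padic :: "('a padic \<times> 'a padic) filter" where
  "uniformity_padic = (INF e\<in>{0 <..}. principal {(x, y). dist x y < e})"
definition open_padic :: "'a padic set \<Rightarrow> bool" where
  "open_padic U \<longleftrightarrow> (\<forall>x\<in>U. eventually (\<lambda>(x', y). x' = x \<longrightarrow> y \<in> U) uniformity)"

instance
proof
  fix x y z :: "'a padic" and U :: "'a padic set"
  show "uniformity = (INF e\<in>{0 <..}. principal {(x :: 'a padic, y). dist x y < e})"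
    by (rule uniformity_padic_def)
  show "open U \<longleftrightarrow> (\<forall>x\<in>U. eventually (\<lambda>(x', y). x' = x \<longrightarrow> y \<in> U) uniformity)"
    by (rule open_padic_def)
  show "dist x y = 0 \<longleftrightarrow> x = y"
    by (simp add: dist_padic_def padic_norm_eq_0_iff)
  have "padic_norm (x - y) \<le> max (padic_norm (x - z)) (padic_norm (z - y))"
    using padic_norm_add_le[of "x - z" "z - y"] by simp
  also have "padic_norm (z - y) = padic_norm (y - z)"
    using padic_norm_minus[of "z - y"] by simp
  finally show "dist x y \<le> dist x z + dist y z"
    using padic_norm_nonneg[of "x - z"] padic_norm_nonneg[of "y - z"]
    by (simp add: dist_padic_def)
qed

end

lemma of_nat_padic_seq: "seq_of (of_nat n :: 'p::prime_card padic_seq) = (\<lambda>_. of_nat n)"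
  by (induction n) (simp_all add: zero_padic_seq.rep_eq one_padic_seq.rep_eq plus_padic_seq.rep_eq)

lemma of_nat_padic: "of_nat n = Padic (of_nat n)"
  by (induction n) (simp_all add: zero_padic.abs_eq one_padic.abs_eq plus_padic.abs_eq)

lemma padic_norm_of_nat:
  "padic_norm (of_nat n :: 'p::prime_card padic) = padic_abs_rat CARD('p) (of_nat n)"
proof -
  have "padic_seq_abs (of_nat n :: 'p padic_seq) = padic_abs_rat CARD('p) (of_nat n)"
    by (rule LIMSEQ_unique[OF padic_seq_abs_LIMSEQ]) (simp add: of_nat_padic_seq)
  thus ?thesis by (simp add: of_nat_padic padic_norm.abs_eq)
qed

instance padic :: (prime_card) field_char_0
proof
  show "inj (of_nat :: nat \<Rightarrow> 'a padic)"
  proof (rule injI, rule ccontr)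
    fix m n :: nat
    assume eq: "(of_nat m :: 'a padic) = of_nat n" and "m \<noteq> n"
    define k where "k = max m n - min m n"
    have "(of_nat k :: 'a padic) = of_nat (max m n) - of_nat (min m n)"
      unfolding k_def by (rule of_nat_diff) simp
    also have "\<dots> = 0" using eq by (simp add: max_def min_def)
    finally have "padic_norm (of_nat k :: 'a padic) = 0" by (simp add: padic_norm_eq_0_iff)
    hence "k = 0" by (simp add: padic_norm_of_nat prime_card)
    thus False using \<open>m \<noteq> n\<close> by (auto simp: k_def max_def min_def split: if_splits)
  qed
qed

lemma padic_norm_of_rat:
  "padic_norm (of_rat q :: 'p::prime_card padic) = padic_abs_rat CARD('p) q"
proof -
  have int: "padic_norm (of_int k :: 'p padic) = padic_abs_rat CARD('p) (of_int k)" for k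
    by (cases k rule: int_cases2)
       (simp_all add: padic_norm_of_nat padic_norm_minus prime_card)
  obtain a b where q: "q = Fract a b" "b > 0" by (metis Rat_cases)
  have qb: "q * of_int b = of_int a" using q by (simp add: Fract_of_int_quotient)
  have "of_rat q * of_int b = (of_int a :: 'p padic)"
    using arg_cong[OF qb, of "of_rat :: rat \<Rightarrow> 'p padic"] by (simp add: of_rat_mult)
  hence "padic_norm (of_rat q :: 'p padic) * padic_norm (of_int b :: 'p padic) = padic_norm (of_int a :: 'p padic)"
    by (simp flip: padic_norm_mult)
  also have "\<dots> = padic_abs_rat CARD('p) q * padic_abs_rat CARD('p) (of_int b)"
    unfolding int qb[symmetric] by (rule padic_abs_rat_mult[OF prime_card])
  finally show ?thesis using q by (simp add: int prime_card)
qed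

lemma of_rat_padic_seq_LIMSEQ:
  assumes X: "padic_Cauchy CARD('p::prime_card) X"
  shows "(\<lambda>n. of_rat (X n)) \<longlonglongrightarrow> (Padic (Padic_Seq X) :: 'p padic)"
proof -
  have const: "seq_of (Padic_Seq (\<lambda>_. q) :: 'p padic_seq) = (\<lambda>_. q)" for q
    by (simp add: Padic_Seq_inverse padic_Cauchy_const[OF prime_card])
  have nat: "of_nat n = Padic (Padic_Seq (\<lambda>_. of_nat n) :: 'p padic_seq)" for n
    unfolding of_nat_padic
    by (rule arg_cong[of _ _ Padic], rule seq_of_inject[THEN iffD1])
       (simp add: const of_nat_padic_seq)
  have neg: "- Padic (Padic_Seq (\<lambda>_. q)) = (Padic (Padic_Seq (\<lambda>_. - q)) :: 'p padic)" for q
    unfolding uminus_padic.abs_eq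
    by (rule arg_cong[of _ _ Padic], rule seq_of_inject[THEN iffD1])
       (simp add: const uminus_padic_seq.rep_eq)
  have int: "of_int k = Padic (Padic_Seq (\<lambda>_. of_int k) :: 'p padic_seq)" for k
    by (cases k rule: int_cases2) (simp_all add: nat neg)
  have mult: "Padic (Padic_Seq (\<lambda>_. q)) * Padic (Padic_Seq (\<lambda>_. r))
               = (Padic (Padic_Seq (\<lambda>_. q * r)) :: 'p padic)" for q r
    unfolding times_padic.abs_eq
    by (rule arg_cong[of _ _ Padic], rule seq_of_inject[THEN iffD1])
       (simp add: const times_padic_seq.rep_eq)
  have rat: "of_rat q = (Padic (Padic_Seq (\<lambda>_. q)) :: 'p padic)" for q
  proof -
    obtain a b where q: "q = Fract a b" "b > 0" by (metis Rat_cases)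
    have qb: "q * of_int b = of_int a" using q by (simp add: Fract_of_int_quotient)
    have "of_rat q * of_int b = (of_int a :: 'p padic)"
      using arg_cong[OF qb, of "of_rat :: rat \<Rightarrow> 'p padic"] by (simp add: of_rat_mult)
    also have "\<dots> = Padic (Padic_Seq (\<lambda>_. q)) * of_int b"
      unfolding int mult qb ..
    finally show ?thesis using q by simp
  qed
  have diff: "seq_of (Padic_Seq (\<lambda>_. q) - Padic_Seq X :: 'p padic_seq) = (\<lambda>m. q - X m)" for q
    using X by (simp add: minus_padic_seq.rep_eq const Padic_Seq_inverse)
  show ?thesis
  proof (rule metric_LIMSEQ_I)
    fix e :: real assume e: "e > 0"
    then obtain k where k: "\<forall>m\<ge>k. \<forall>n\<ge>k. padic_abs_rat CARD('p) (X m - X n) < e / 2"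
      using X half_gt_zero unfolding padic_Cauchy_def by blast
    have "dist (of_rat (X n)) (Padic (Padic_Seq X) :: 'p padic) < e" if n: "n \<ge> k" for n
    proof -
      have "dist (of_rat (X n)) (Padic (Padic_Seq X) :: 'p padic) \<le> e / 2"
        unfolding dist_padic_def rat minus_padic.abs_eq padic_norm.abs_eq
        by (rule LIMSEQ_le_const2[OF padic_seq_abs_LIMSEQ], unfold diff)
           (use k n less_imp_le in blast)
      thus ?thesis using e by simp
    qed
    thus "\<exists>no. \<forall>n\<ge>no. dist (of_rat (X n)) (Padic (Padic_Seq X) :: 'p padic) < e" by blast
  qed
qed

lemma padic_rat_approx:
  assumes "e > 0"
  obtains q where "dist (of_rat q) (x :: 'p::prime_card padic) < e"
proof -
  obtain X where X: "padic_Cauchy CARD('p) X" and x: "x = Padic (Padic_Seq X)"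
    by (metis Quotient_abs_rep[OF Quotient_padic] mem_Collect_eq seq_of seq_of_inverse)
  show ?thesis
    using metric_LIMSEQ_D[OF of_rat_padic_seq_LIMSEQ[OF X] assms] that unfolding x by blast
qed

lemma closure_of_rat_padic: "closure (range of_rat) = (UNIV :: 'p::prime_card padic set)"
proof (rule set_eqI)
  fix x :: "'p padic"
  have "x \<in> closure (range of_rat)"
    unfolding closure_approachable using padic_rat_approx[of _ x] by (meson rangeI)
  thus "x \<in> closure (range of_rat) \<longleftrightarrow> x \<in> UNIV" by simp
qed

instance padic :: (prime_card) complete_space
proof
  fix Y :: "nat \<Rightarrow> 'a padic"
  assume Y: "Cauchy Y"
  have "\<exists>q. dist (of_rat q) (Y n) < inverse (real (Suc n))" for n
    by (rule padic_rat_approx[of "inverse (real (Suc n))" "Y n"]) auto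
  then obtain X where X: "\<And>n. dist (of_rat (X n)) (Y n) < inverse (real (Suc n))" by metis
  have XY: "(\<lambda>n. dist (of_rat (X n)) (Y n)) \<longlonglongrightarrow> 0"
    by (rule tendsto_sandwich[OF _ _ tendsto_const LIMSEQ_inverse_real_of_nat])
       (use X in \<open>auto simp: less_imp_le\<close>)
  have "padic_Cauchy CARD('a) X"
    unfolding padic_Cauchy_def
  proof (intro allI impI)
    fix e :: real assume e: "e > 0"
    obtain k where k: "\<And>m n. m \<ge> k \<Longrightarrow> n \<ge> k \<Longrightarrow> dist (Y m) (Y n) < e / 3"
      using metric_CauchyD[OF Y, of "e / 3"] e by auto
    obtain l where l: "\<And>n. n \<ge> l \<Longrightarrow> dist (of_rat (X n)) (Y n) < e / 3"
      using order_tendstoD(2)[OF XY, of "e / 3"] e by (auto simp: eventually_sequentially)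
    have "padic_abs_rat CARD('a) (X m - X n) < e" if mn: "m \<ge> max k l" "n \<ge> max k l" for m n
    proof -
      have "padic_abs_rat CARD('a) (X m - X n) = dist (of_rat (X m)) (of_rat (X n) :: 'a padic)"
        by (simp add: dist_padic_def padic_norm_of_rat flip: of_rat_diff)
      also have "\<dots> \<le> dist (of_rat (X m)) (Y m) + dist (Y m) (Y n) + dist (of_rat (X n)) (Y n)"
        using dist_triangle[of "of_rat (X m)" "of_rat (X n)" "Y m"]
          dist_triangle[of "Y m" "of_rat (X n)" "Y n"] by (simp add: dist_commute)
      also have "\<dots> < e"
        using k[of m n] l[of m] l[of n] mn by simp
      finally show ?thesis .
    qed
    thus "\<exists>k. \<forall>m\<ge>k. \<forall>n\<ge>k. padic_abs_rat CARD('a) (X m - X n) < e" by blast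
  qed
  hence lim: "(\<lambda>n. of_rat (X n)) \<longlonglongrightarrow> (Padic (Padic_Seq X) :: 'a padic)"
    by (rule of_rat_padic_seq_LIMSEQ)
  have "(\<lambda>n. dist (of_rat (X n)) (Y n) + dist (of_rat (X n)) (Padic (Padic_Seq X) :: 'a padic))
          \<longlonglongrightarrow> 0 + 0"
    by (intro tendsto_add XY tendsto_dist_iff[THEN iffD1] lim)
  hence "(\<lambda>n. dist (of_rat (X n)) (Y n) + dist (of_rat (X n)) (Padic (Padic_Seq X) :: 'a padic))
          \<longlonglongrightarrow> 0" by simp
  hence "(\<lambda>n. dist (Y n) (Padic (Padic_Seq X))) \<longlonglongrightarrow> 0"
    by (rule tendsto_sandwich[OF always_eventually always_eventually tendsto_const, rotated 2])
       (simp_all add: dist_triangle3)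
  hence "Y \<longlonglongrightarrow> Padic (Padic_Seq X)"
    by (rule tendsto_dist_iff[THEN iffD2])
  thus "convergent Y" by (rule convergentI)
qed


section \<open>Integration on the p-adic numbers\<close>

text \<open>
  The regularity condition in the definition of a Haar measure is automatic here, because the
  space is metrizable and a countable union of compact sets. Existence and uniqueness of the
  normalized measure are the standard theorem of Haar.
\<close>

definition normalized_Haar :: "'p::prime_card padic measure \<Rightarrow> bool" where
  "normalized_Haar M \<longleftrightarrow>
     sets M = sets borel \<and>
     (\<forall>a. \<forall>A\<in>sets M. emeasure M ((+) a ` A) = emeasure M A) \<and>
     (\<forall>K. compact K \<longrightarrow> emeasure M K < \<infinity>) \<and>
     emeasure M {y. padic_norm y \<le> 1} = 1"

definition locally_integrable :: "'a::topological_space measure \<Rightarrow> ('a \<Rightarrow> real) \<Rightarrow> bool" where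
  "locally_integrable M f \<longleftrightarrow> (\<forall>K. compact K \<longrightarrow> set_integrable M K f)"

definition padic_at_infinity :: "'p::prime_card padic filter" where
  "padic_at_infinity = filtercomap padic_norm at_top"

definition frac_const :: "nat \<Rightarrow> real \<Rightarrow> real" where
  "frac_const p \<alpha> = (1 - real p powr (- \<alpha>)) / (1 - real p powr (\<alpha> - 1))"

definition frac_integral ::
    "'p::prime_card padic measure \<Rightarrow> real \<Rightarrow> ('p padic \<Rightarrow> real) \<Rightarrow> 'p padic \<Rightarrow> real" where
  "frac_integral M \<alpha> f x =
     frac_const CARD('p) \<alpha> *
     (LINT y:{y. padic_norm y \<le> padic_norm x}|M.
        (padic_norm (x - y) powr (\<alpha> - 1) - padic_norm y powr (\<alpha> - 1)) * f y)"

text \<open>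
  The conventions \<open>ln 0 = 0\<close> and \<open>0 powr a = 0\<close> only affect the integrand at the
  single point \<open>t = 0\<close>, which is a null set.
\<close>

definition Omega :: "'p::prime_card padic measure \<Rightarrow> nat \<Rightarrow> real \<Rightarrow> real \<Rightarrow> real" where
  "Omega M k \<alpha> \<beta> =
     (LINT t:{t. padic_norm t \<le> 1}|M.
        (padic_norm (1 - t) powr (\<alpha> - 1) - padic_norm t powr (\<alpha> - 1))
          * padic_norm t powr (- \<beta>) * ln (padic_norm t) ^ k)"

definition expansion_coeff ::
    "'p::prime_card padic measure \<Rightarrow> (nat \<Rightarrow> real) \<Rightarrow> real \<Rightarrow> real \<Rightarrow> real \<Rightarrow> nat \<Rightarrow> real" where
  "expansion_coeff M a \<alpha> \<beta> \<gamma> n =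
     (\<Sum>k\<le>n. a (n - k) * ((\<gamma> + real k - real n) gchoose k) * Omega M k \<alpha> \<beta>)"

end

theory Submission
  imports Defs "HOL-Number_Theory.Cong" "HOL-Real_Asymp.Real_Asymp"
begin

text \<open>
  The substitution \<open>y = x t\<close> gives
  \<open>(I\<^sup>\<alpha> f) x = c \<bar>x\<bar>\<^sup>\<alpha> \<integral> K t f(x t) dt\<close> over the unit ball, where
  \<open>K t = \<bar>1 - t\<bar> powr (\<alpha> - 1) - \<bar>t\<bar> powr (\<alpha> - 1)\<close> is bounded by 1. With
  \<open>L = ln \<bar>x\<bar>\<close> and \<open>l = ln \<bar>t\<bar>\<close>, the coefficients \<open>B\<^sub>n\<close> come
  from the binomial expansion of \<open>(L + l) powr (\<gamma> - n)\<close> in powers of \<open>l / L\<close>.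
  The ball is cut at \<open>\<bar>x t\<bar> = \<bar>x\<bar> powr \<delta>\<close> with \<open>\<delta> = (1 - \<beta>) / 4\<close>. Outside the cut the
  expansion of \<open>f\<close> applies and \<open>l / L \<ge> - (1 - \<delta>)\<close> stays away from \<open>-1\<close>, so
  the Taylor remainder is uniform. Inside, the crude bound \<open>f y \<le> \<bar>y\<bar>\<close> for large \<open>y\<close> makes the
  contribution of \<open>f\<close> a negative power of \<open>\<bar>x\<bar>\<close>, and \<open>1 \<le> \<bar>l\<bar> / ((1 - \<delta>) L)\<close> makes
  that of the expansion of lower order. All errors are thus bounded by multiples of the integrable function
  \<open>\<bar>t\<bar> powr (- \<beta>) (1 + \<bar>l\<bar>) ^ (N + 1)\<close>.
\<close>

section \<open>Absolute values and balls\<close>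

lemma padic_norm_zero [simp]: "padic_norm 0 = 0"
  by (simp add: padic_norm_eq_0_iff)

lemma padic_norm_minus_commute: "padic_norm (x - y) = padic_norm (y - x)"
  using padic_norm_minus[of "x - y"] by simp

lemma padic_norm_inverse: "padic_norm (inverse x) = inverse (padic_norm x)"
proof (cases "x = 0")
  case False
  then have "padic_norm x * padic_norm (inverse x) = 1"
    by (simp add: padic_norm_one flip: padic_norm_mult)
  then show ?thesis
    by (metis inverse_unique)
qed simp

lemma padic_norm_divide: "padic_norm (x / y) = padic_norm x / padic_norm y"
  by (simp add: divide_inverse padic_norm_mult padic_norm_inverse)

lemma padic_norm_power: "padic_norm (x ^ n) = padic_norm x ^ n"
  by (induction n) (simp_all add: padic_norm_one padic_norm_mult)

lemma padic_norm_power_int: "padic_norm (x powi k) = padic_norm x powi k"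
  by (cases k rule: int_cases3)
     (simp_all add: power_int_minus padic_norm_inverse padic_norm_power padic_norm_one)

lemma padic_norm_diff_le: "padic_norm (x - y) \<le> max (padic_norm x) (padic_norm y)"
  using padic_norm_add_le[of x "- y"] by (simp add: padic_norm_minus)

text \<open>In an ultrametric triangle the two longest sides are equal, so a perturbation smaller
  than \<open>padic_norm x\<close> cannot change the absolute value.\<close>

lemma padic_norm_eq_of_diff_less:
  assumes "padic_norm (x - y) < padic_norm x"
  shows "padic_norm y = padic_norm x"
  using assms padic_norm_diff_le[of x "x - y"] padic_norm_diff_le[of y "y - x"]
    padic_norm_minus_commute[of x y] by simp

lemma dist_padic_le_max: "dist x z \<le> max (dist x y) (dist y (z :: 'p::prime_card padic))"
  using padic_norm_add_le[of "x - y" "y - z"] by (simp add: dist_padic_def)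

lemma padic_cball_0: "cball 0 r = {y :: 'p::prime_card padic. padic_norm y \<le> r}"
  by (auto simp: dist_padic_def padic_norm_minus)

lemma prime_card_gt_1: "real CARD('p::prime_card) > 1"
  using prime_gt_1_nat[OF prime_card, where 'a1 = 'p] by simp

section \<open>The value group and residues modulo the prime\<close>

text \<open>A rational closer to \<open>x\<close> than \<open>padic_norm x\<close> has the same
  absolute value as \<open>x\<close>, and nonzero rationals have powers of p as absolute values by
  definition.\<close>

lemma padic_norm_values:
  fixes x :: "'p::prime_card padic"
  assumes "x \<noteq> 0"
  obtains k :: int where "padic_norm x = real CARD('p) powi k"
proof -
  have "padic_norm x > 0"
    using assms padic_norm_nonneg[of x] padic_norm_eq_0_iff[of x] by simp
  then obtain q where "dist (of_rat q) x < padic_norm x"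
    by (rule padic_rat_approx)
  then have "padic_norm (of_rat q :: 'p padic) = padic_norm x"
    by (intro padic_norm_eq_of_diff_less) (simp add: dist_padic_def padic_norm_minus_commute)
  then have "padic_norm x = padic_abs_rat CARD('p) q"
    by (simp add: padic_norm_of_rat)
  moreover from this have "q \<noteq> 0"
    using \<open>padic_norm x > 0\<close> by (auto simp: prime_card)
  ultimately show ?thesis
    using that by (simp add: padic_abs_rat_def)
qed

lemma padic_norm_of_int:
  assumes "m \<noteq> 0"
  shows "padic_norm (of_int m :: 'p::prime_card padic) =
    real CARD('p) powi (- int (multiplicity (int CARD('p)) m))"
proof -
  have "of_rat (Fract m 1) = (of_int m :: 'p padic)"
    by (simp add: of_rat_rat)
  then show ?thesis
    using padic_norm_of_rat[of "Fract m 1", where 'p = 'p] assms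
    by (simp add: padic_abs_rat_Fract[OF prime_card])
qed

lemma padic_norm_of_int_not_dvd:
  assumes "\<not> int CARD('p::prime_card) dvd m"
  shows "padic_norm (of_int m :: 'p padic) = 1"
  using assms by (cases "m = 0") (simp_all add: padic_norm_of_int not_dvd_imp_multiplicity_0)

lemma padic_norm_of_int_dvd:
  assumes "int CARD('p::prime_card) dvd m"
  shows "padic_norm (of_int m :: 'p padic) \<le> 1 / real CARD('p)"
proof (cases "m = 0")
  case False
  have "\<not> is_unit (int CARD('p))" using prime_card[where 'a = 'p] by auto
  then have "multiplicity (int CARD('p)) m \<ge> 1"
    using assms False by (intro multiplicity_geI) auto
  then have "real CARD('p) powi (- int (multiplicity (int CARD('p)) m)) \<le> real CARD('p) powi (- 1)"
    using prime_card_gt_1[where 'p = 'p] by (intro power_int_increasing) auto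
  then show ?thesis
    using False by (simp add: padic_norm_of_int power_int_minus field_simps)
qed simp

lemma padic_norm_of_prime: "padic_norm (of_nat CARD('p) :: 'p::prime_card padic) = 1 / real CARD('p)"
proof -
  have "multiplicity (int CARD('p)) (int CARD('p)) = 1"
    using prime_card[where 'a = 'p] by (intro multiplicity_prime) auto
  then show ?thesis
    using padic_norm_of_int[of "int CARD('p)", where 'p = 'p] prime_card_gt_1[where 'p = 'p]
    by (simp add: power_int_minus field_simps)
qed

text \<open>This extracts the first p-adic digit. A rational a/b close to \<open>x\<close> has a
  denominator prime to p, so a/b can be reduced modulo p. Accuracy 1/p in both steps suffices,
  because ultrametric errors do not add up.\<close>

lemma padic_integer_residue:
  fixes x :: "'p::prime_card padic"
  assumes "padic_norm x \<le> 1"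
  obtains i where "i < CARD('p)" "padic_norm (x - of_nat i) \<le> 1 / real CARD('p)"
proof -
  let ?p = "int CARD('p)"
  have pp: "prime ?p" "?p > 1" using prime_card[where 'a = 'p] prime_gt_1_nat[OF prime_card, where 'a1 = 'p] by auto
  obtain q where q: "dist (of_rat q) x < 1 / real CARD('p)"
    using padic_rat_approx[of "1 / real CARD('p)"] prime_card_gt_1[where 'p = 'p] by auto
  obtain a b where ab: "q = Fract a b" "b > 0" "coprime a b" by (rule Rat_cases)
  have qx: "padic_norm (x - of_rat q) \<le> 1 / real CARD('p)" using q by (simp add: dist_padic_def padic_norm_minus_commute)
  then have "padic_norm (x - of_rat q) \<le> 1" using prime_card_gt_1[where 'p = 'p]
    by (auto intro: order.trans)
  then have q1: "padic_norm (of_rat q :: 'p padic) \<le> 1"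
    using padic_norm_diff_le[of x "x - of_rat q"] assms by simp
  have qeq: "(of_rat q :: 'p padic) = of_int a / of_int b"
    using ab by (simp add: of_rat_rat)
  \<comment> \<open>If p divided \<open>b\<close>, coprimality would give \<open>a\<close> absolute
    value 1, and a/b would have absolute value larger than 1.\<close>
  have b: "\<not> ?p dvd b"
  proof
    assume d: "?p dvd b"
    then have "\<not> ?p dvd a" using ab(3) pp
      by (metis coprime_common_divisor not_prime_unit)
    then have "padic_norm (of_rat q :: 'p padic) = 1 / padic_norm (of_int b :: 'p padic)"
      by (simp add: qeq padic_norm_divide padic_norm_of_int_not_dvd)
    moreover have "padic_norm (of_int b :: 'p padic) > 0"
      using ab(2) padic_norm_nonneg[of "of_int b :: 'p padic"] padic_norm_eq_0_iff[of "of_int b :: 'p padic"] by simp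
    ultimately have "padic_norm (of_int b :: 'p padic) \<ge> 1" using q1
      by (simp add: pos_divide_le_eq)
    moreover have "1 / real CARD('p) < 1"
      using prime_card_gt_1[where 'p = 'p] by simp
    ultimately show False using padic_norm_of_int_dvd[OF d] by simp
  qed
  then have "coprime b ?p" using pp(1) prime_imp_coprime coprime_commute by metis
  then obtain c where c: "[b * c = 1] (mod ?p)" using cong_solve_coprime_int by blast
  define i where "i = nat ((a * c) mod ?p)"
  have i: "int i = (a * c) mod ?p" using pp by (simp add: i_def)
  have "i < CARD('p)" using i pp by (metis of_nat_less_iff pos_mod_bound int_one_le_iff_zero_less less_le_trans zero_less_one less_trans)
  \<comment> \<open>Since \<open>c\<close> inverts \<open>b\<close> modulo p, \<open>i\<close>
    represents a/b: the difference a/b - i is a multiple of p divided by the unit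
    \<open>b\<close>.\<close>
  have "[b * int i = b * (a * c)] (mod ?p)" unfolding i by (simp add: cong_def mod_mult_right_eq)
  also have "[b * (a * c) = a] (mod ?p)" using cong_scalar_left[OF c, of a] by (simp add: mult.left_commute)
  finally have "?p dvd a - b * int i" by (simp add: cong_iff_dvd_diff cong_sym dvd_diff_commute)
  then have "padic_norm (of_int (a - b * int i) :: 'p padic) \<le> 1 / real CARD('p)"
    by (rule padic_norm_of_int_dvd)
  moreover have "(of_rat q - of_nat i :: 'p padic) = of_int (a - b * int i) / of_int b"
    using ab(2) by (simp add: qeq diff_divide_distrib)
  ultimately have "padic_norm (of_rat q - of_nat i :: 'p padic) \<le> 1 / real CARD('p)"
    using b by (simp add: padic_norm_divide padic_norm_of_int_not_dvd)
  then have "padic_norm (x - of_nat i) \<le> 1 / real CARD('p)"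
    using qx padic_norm_add_le[of "x - of_rat q" "of_rat q - of_nat i"] by simp
  then show ?thesis using that \<open>i < CARD('p)\<close> by blast
qed

lemma padic_norm_of_nat_diff:
  assumes "i < CARD('p::prime_card)" "j < CARD('p)" "i \<noteq> j"
  shows "padic_norm (of_nat i - of_nat j :: 'p padic) = 1"
proof -
  have "\<not> int CARD('p) dvd int i - int j"
    using assms zdvd_not_zless[of "\<bar>int i - int j\<bar>" "int CARD('p)"] by auto
  from padic_norm_of_int_not_dvd[OF this] show ?thesis by simp
qed

section \<open>Geometry of balls\<close>

text \<open>Every point of an ultrametric ball is a centre of it, so two balls are either nested or
  disjoint.\<close>

lemma padic_cball_absorb:
  fixes a :: "'p::prime_card padic"
  assumes "z \<in> cball a r" "z \<in> cball b s" "r \<le> s"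
  shows "cball a r \<subseteq> cball b s"
proof
  fix y assume "y \<in> cball a r"
  then have "dist z y \<le> r"
    using assms(1) dist_padic_le_max[of z y a] by (simp add: dist_commute)
  then show "y \<in> cball b s"
    using assms(2,3) dist_padic_le_max[of b y z] by simp
qed

text \<open>Dividing \<open>y - a\<close> by \<open>d (k + 1)\<close> lands in the p-adic integers,
  and the residue modulo p selects the subball. Distinct residues differ by a unit, so the centres
  are further apart than the small radius. This self-similarity drives both compactness and the
  computation of the measure of balls.\<close>

lemma padic_cball_split:
  fixes a :: "'p::prime_card padic"
  defines "d \<equiv> \<lambda>k::int. of_nat CARD('p) powi (- k) :: 'p padic"
  shows "cball a (real CARD('p) powi (k + 1)) =
      (\<Union>i<CARD('p). cball (a + of_nat i * d (k + 1)) (real CARD('p) powi k))"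
    and "disjoint_family_on (\<lambda>i. cball (a + of_nat i * d (k + 1)) (real CARD('p) powi k)) {..<CARD('p)}"
proof -
  let ?p = "real CARD('p)"
  have p: "?p > 1" by (rule prime_card_gt_1)
  \<comment> \<open>The prime itself has absolute value 1/p, hence the negative exponent in
    \<open>d\<close>.\<close>
  have d: "padic_norm (d k) = ?p powi k" for k
    by (simp add: d_def padic_norm_power_int padic_norm_of_prime power_int_minus
        padic_norm_inverse power_int_divide_distrib)
  have d0: "d k \<noteq> 0" for k
    using p by (simp add: d_def power_int_eq_0_iff)
  have pk: "?p powi (k + 1) = ?p * ?p powi k"
    using p by (simp add: power_int_add)
  have le: "?p powi k \<le> ?p powi (k + 1)"
    using p by (intro power_int_increasing) auto
  show "cball a (?p powi (k + 1)) = (\<Union>i<CARD('p). cball (a + of_nat i * d (k + 1)) (?p powi k))"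
  proof (intro equalityI subsetI)
    fix y assume y: "y \<in> cball a (?p powi (k + 1))"
    then have "padic_norm ((y - a) / d (k + 1)) \<le> 1"
      using p padic_norm_minus_commute[of y a] by (simp add: padic_norm_divide d dist_padic_def)
    then obtain i where i: "i < CARD('p)" "padic_norm ((y - a) / d (k + 1) - of_nat i) \<le> 1 / ?p"
      by (rule padic_integer_residue)
    have "y - (a + of_nat i * d (k + 1)) = ((y - a) / d (k + 1) - of_nat i) * d (k + 1)"
      using d0[of "k + 1"] by (simp add: field_simps)
    then have "padic_norm (y - (a + of_nat i * d (k + 1))) \<le> (1 / ?p) * ?p powi (k + 1)"
      using i(2) p by (simp only: padic_norm_mult d) (intro mult_right_mono, auto)
    then show "y \<in> (\<Union>i<CARD('p). cball (a + of_nat i * d (k + 1)) (?p powi k))"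
      using i(1) p padic_norm_minus_commute[of y "a + of_nat i * d (k + 1)"]
      by (auto simp: pk dist_padic_def intro!: bexI[of _ i])
  next
    fix y assume "y \<in> (\<Union>i<CARD('p). cball (a + of_nat i * d (k + 1)) (?p powi k))"
    then obtain i where i: "dist (a + of_nat i * d (k + 1)) y \<le> ?p powi k"
      by auto
    have "padic_norm (of_nat i :: 'p padic) \<le> 1"
    proof (cases "i = 0")
      case False
      then show ?thesis
        using padic_norm_of_int[of "int i", where 'p = 'p] p
          power_int_increasing[of "- int (multiplicity (int CARD('p)) (int i))" 0 ?p] by simp
    qed simp
    then have "dist a (a + of_nat i * d (k + 1)) \<le> ?p powi (k + 1)"
      using p by (simp add: dist_padic_def padic_norm_minus padic_norm_mult d mult_left_le_one_le padic_norm_nonneg)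
    then show "y \<in> cball a (?p powi (k + 1))"
      using i le dist_padic_le_max[of a y "a + of_nat i * d (k + 1)"] by simp
  qed
  show "disjoint_family_on (\<lambda>i. cball (a + of_nat i * d (k + 1)) (?p powi k)) {..<CARD('p)}"
    unfolding disjoint_family_on_def
  proof (intro ballI impI, rule ccontr)
    fix i j assume ij: "i \<in> {..<CARD('p)}" "j \<in> {..<CARD('p)}" "i \<noteq> j"
      and "cball (a + of_nat i * d (k + 1)) (?p powi k) \<inter> cball (a + of_nat j * d (k + 1)) (?p powi k) \<noteq> {}"
    then obtain y where "dist (a + of_nat i * d (k + 1)) y \<le> ?p powi k"
      "dist y (a + of_nat j * d (k + 1)) \<le> ?p powi k"
      by (auto simp: dist_commute)
    then have "dist (a + of_nat i * d (k + 1)) (a + of_nat j * d (k + 1)) \<le> ?p powi k"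
      using dist_padic_le_max[of "a + of_nat i * d (k + 1)" "a + of_nat j * d (k + 1)" y] by simp
    moreover have "dist (a + of_nat i * d (k + 1)) (a + of_nat j * d (k + 1)) =
        padic_norm ((of_nat i - of_nat j) * d (k + 1))"
      by (simp add: dist_padic_def algebra_simps)
    moreover have "\<dots> = ?p powi (k + 1)"
      using ij by (simp add: padic_norm_mult d padic_norm_of_nat_diff)
    ultimately show False
      using p power_int_strict_increasing[of k "k + 1" ?p] by simp
  qed
qed

lemma powi_cofinal:
  assumes "b > (1::real)"
  obtains n where "x \<le> b powi int n"
proof -
  obtain n where "x < b ^ n" using real_arch_pow[OF assms] by blast
  then show ?thesis by (intro that[of n]) simp
qed

lemma powi_coinitial:
  assumes "b > (1::real)" "x > 0"
  obtains n where "b powi (- int n) < x"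
proof -
  obtain n where n: "1 / x < b ^ n" using real_arch_pow[OF assms(1)] by blast
  have "b powi (- int n) < x"
    using n assms by (simp add: power_int_minus field_simps)
  then show ?thesis by (rule that)
qed

text \<open>The distances are discrete, so rounding the radius down to a power of p removes no
  point.\<close>

lemma padic_cball_radius:
  assumes "r > 0"
  obtains k where "real CARD('p) powi k \<le> r"
    "\<And>a :: 'p::prime_card padic. cball a r = cball a (real CARD('p) powi k)"
proof -
  let ?p = "real CARD('p)"
  have p: "?p > 1" by (rule prime_card_gt_1)
  define k where "k = \<lfloor>log ?p r\<rfloor>"
  have "?p powr real_of_int k \<le> r" "r < ?p powr real_of_int (k + 1)"
    using p assms by (auto simp: k_def powr_le_iff less_powr_iff)
  then have k: "?p powi k \<le> r" "r < ?p powi (k + 1)"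
    using p powr_real_of_int'[of ?p k] powr_real_of_int'[of ?p "k + 1"] by auto
  have "cball a r = cball a (?p powi k)" for a :: "'p padic"
  proof (intro equalityI subsetI)
    fix y assume y: "y \<in> cball a r"
    show "y \<in> cball a (?p powi k)"
    proof (cases "y = a")
      case False
      then obtain j where j: "padic_norm (a - y) = ?p powi j"
        using padic_norm_values[of "a - y"] by auto
      then have "?p powi j < ?p powi (k + 1)"
        using y k by (simp add: dist_padic_def)
      then have "j < k + 1"
        using p power_int_increasing[of "k + 1" j ?p] by linarith
      then have "?p powi j \<le> ?p powi k"
        using p by (intro power_int_increasing) auto
      then show ?thesis by (simp add: dist_padic_def j)
    qed (use p in auto)
  qed (use k in auto)
  with k(1) show ?thesis by (rule that)
qed

section \<open>Compactness and generation of the Borel sets\<close>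

lemma padic_cball_totally_bounded:
  fixes a :: "'p::prime_card padic"
  shows "\<exists>F. finite F \<and> cball a (real CARD('p) powi (k + int n)) \<subseteq> (\<Union>x\<in>F. cball x (real CARD('p) powi k))"
proof (induction n arbitrary: a)
  case 0
  show ?case by (rule exI[of _ "{a}"]) simp
next
  case (Suc n)
  let ?d = "of_nat CARD('p) powi (- (k + int n + 1)) :: 'p padic"
  from Suc obtain F where F: "finite (F x)"
      "cball x (real CARD('p) powi (k + int n)) \<subseteq> (\<Union>x\<in>F x. cball x (real CARD('p) powi k))" for x :: "'p padic"
    by metis
  have "cball a (real CARD('p) powi (k + int n + 1)) \<subseteq>
      (\<Union>x\<in>(\<Union>i<CARD('p). F (a + of_nat i * ?d)). cball x (real CARD('p) powi k))"
    unfolding padic_cball_split(1)[of a "k + int n"] using F(2) by blast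
  then show ?case
    using F(1) by (intro exI[of _ "\<Union>i<CARD('p). F (a + of_nat i * ?d)"]) (auto simp: algebra_simps)
qed

text \<open>Repeated splitting makes balls totally bounded, and they are closed in a complete space.
  This is what makes local integrability applicable to balls.\<close>

lemma compact_padic_cball: "compact (cball (a :: 'p::prime_card padic) r)"
proof -
  let ?p = "real CARD('p)"
  have p: "?p > 1" by (rule prime_card_gt_1)
  obtain m where m: "r \<le> ?p powi int m"
    using powi_cofinal[OF p] .
  have "\<exists>F. finite F \<and> cball a r \<subseteq> (\<Union>x\<in>F. ball x e)" if e: "e > 0" for e
  proof -
    obtain n where n: "?p powi (- int n) < e"
      using powi_coinitial[OF p e] .
    \<comment> \<open>Splitting \<open>m + n\<close> times brings the radius from p^m down to
      p^(-n).\<close>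
    obtain F where F: "finite F" "cball a (?p powi (- int n + int (m + n))) \<subseteq> (\<Union>x\<in>F. cball x (?p powi (- int n)))"
      using padic_cball_totally_bounded[of a "- int n" "m + n"] by blast
    have "cball a r \<subseteq> cball a (?p powi (- int n + int (m + n)))"
      using m by (intro subset_cball) simp
    also note F(2)
    also have "(\<Union>x\<in>F. cball x (?p powi (- int n))) \<subseteq> (\<Union>x\<in>F. ball x e)"
      using n by (intro UN_mono) auto
    finally show ?thesis using F(1) by blast
  qed
  moreover have "complete (cball a r)"
    by (simp add: complete_eq_closed)
  ultimately show ?thesis
    unfolding compact_eq_totally_bounded by blast
qed

text \<open>Balls with rational centre and radius a power of p form a countable family, and every
  open set is a union of such balls by density of the rationals.\<close>

lemma borel_eq_padic_cballs:
  "sets (borel :: 'p::prime_card padic measure) =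
    sigma_sets UNIV (insert {} (range (\<lambda>(a, k::int). cball a (real CARD('p) powi k))))" (is "_ = sigma_sets UNIV ?E")
proof -
  let ?p = "real CARD('p)"
  have p: "?p > 1" by (rule prime_card_gt_1)
  have "sigma_sets UNIV {S. open S} = sigma_sets UNIV ?E"
  proof (rule sigma_sets_eqI)
    fix U :: "'p padic set" assume "U \<in> {S. open S}"
    then have U: "open U" by simp
    define I where "I = {(q::rat, n::int). cball (of_rat q) (?p powi n) \<subseteq> U}"
    have "U \<subseteq> (\<Union>(q, n)\<in>I. cball (of_rat q) (?p powi n))"
    proof
      fix x assume "x \<in> U"
      then obtain e where e: "e > 0" "ball x e \<subseteq> U" using U openE by blast
      obtain n where n: "?p powi (- int n) < e" using powi_coinitial[OF p e(1)] .
      obtain q where q: "dist (of_rat q) x < ?p powi (- int n)"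
        using padic_rat_approx[of "?p powi (- int n)" x] p by auto
      \<comment> \<open>The rational centre is within the radius of \<open>x\<close>, so moving the
        centre does not lead out of the ball around \<open>x\<close>.\<close>
      have "cball (of_rat q) (?p powi (- int n)) \<subseteq> cball x (?p powi (- int n))"
        by (rule padic_cball_absorb[of "of_rat q"]) (use q p in \<open>auto simp: dist_commute\<close>)
      also have "\<dots> \<subseteq> U" using n e by auto
      finally show "x \<in> (\<Union>(q, n)\<in>I. cball (of_rat q) (?p powi n))"
        using q by (auto simp: I_def less_imp_le intro!: exI[of _ q] exI[of _ "- int n"])
    qed
    then have "U = (\<Union>(q, n)\<in>I. cball (of_rat q) (?p powi n))"
      by (auto simp: I_def)
    also have "\<dots> \<in> sigma_sets UNIV ?E"
      by (rule sigma_sets_UNION) (auto simp: countable_subset[OF subset_UNIV])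
    finally show "U \<in> sigma_sets UNIV ?E" .
  next
    fix S assume "S \<in> ?E"
    then have "closed S" by auto
    then have "UNIV - (UNIV - S) \<in> sigma_sets UNIV {S :: 'p padic set. open S}"
      by (intro sigma_sets.Compl sigma_sets.Basic) (simp add: Compl_eq_Diff_UNIV[symmetric] open_Compl)
    then show "S \<in> sigma_sets UNIV {S. open S}" by (simp add: double_diff)
  qed
  then show ?thesis by (simp add: borel_def)
qed

text \<open>Balls that meet are nested, so together with the empty set they form an
  intersection-stable generator, exhausted by balls of finite measure.\<close>

lemma padic_measure_eqI:
  fixes M N :: "'p::prime_card padic measure"
  assumes "sets M = sets borel" "sets N = sets borel"
    and "\<And>a k. emeasure M (cball a (real CARD('p) powi k)) = emeasure N (cball a (real CARD('p) powi k))"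
    and "\<And>k. emeasure M (cball 0 (real CARD('p) powi k)) \<noteq> \<infinity>"
  shows "M = N"
proof (rule measure_eqI_generator_eq)
  let ?p = "real CARD('p)"
  let ?E = "insert {} (range (\<lambda>(a :: 'p padic, k::int). cball a (?p powi k)))"
  show "Int_stable ?E"
  proof (rule Int_stableI)
    have wlog: "cball a r \<inter> cball b s \<in> {{}, cball a r}" if "r \<le> s" for a b :: "'p padic" and r s
      using padic_cball_absorb[OF _ _ that, of _ a b] by blast
    have "cball a (?p powi k) \<inter> cball b (?p powi l) \<in> {{}, cball a (?p powi k), cball b (?p powi l)}"
      for a b :: "'p padic" and k l :: int
      using wlog[of "?p powi k" "?p powi l" a b] wlog[of "?p powi l" "?p powi k" b a]
      by (cases "?p powi k \<le> ?p powi l") (auto simp: Int_commute)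
    then have "cball a (?p powi k) \<inter> cball b (?p powi l) \<in> ?E" for a b :: "'p padic" and k l :: int
      by (rule subsetD[rotated]) auto
    then show "A \<inter> B \<in> ?E" if AB: "A \<in> ?E" "B \<in> ?E" for A B
    proof (cases "A = {} \<or> B = {}")
      case False
      obtain a k where "A = cball a (?p powi k)"
        using AB(1) False by (elim insertE rangeE) auto
      moreover obtain b l where "B = cball b (?p powi l)"
        using AB(2) False by (elim insertE rangeE) auto
      ultimately show ?thesis using \<open>\<And>b a l k. cball a (?p powi k) \<inter> cball b (?p powi l) \<in> ?E\<close> by (simp only:)
    qed auto
  qed
  show "sets M = sigma_sets UNIV ?E" "sets N = sigma_sets UNIV ?E"
    using assms borel_eq_padic_cballs by auto
  show "(\<Union>n. cball 0 (?p powi int n)) = (UNIV :: 'p padic set)"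
  proof (intro equalityI subsetI UNIV_I)
    fix x :: "'p padic"
    obtain n where "dist 0 x \<le> ?p powi int n"
      using powi_cofinal[OF prime_card_gt_1] .
    then show "x \<in> (\<Union>n. cball 0 (?p powi int n))" by auto
  qed
  show "range (\<lambda>n. cball 0 (?p powi int n)) \<subseteq> ?E"
    by blast
  show "emeasure M (cball 0 (?p powi int n)) \<noteq> \<infinity>" for n
    by (rule assms)
qed (use assms(3) in auto)

section \<open>Continuity and measurability\<close>

lemma continuous_on_padic_norm: "continuous_on UNIV (padic_norm :: 'p::prime_card padic \<Rightarrow> real)"
proof -
  have "continuous_on UNIV (\<lambda>x :: 'p padic. dist 0 x)"
    by (intro continuous_intros)
  then show ?thesis by (simp add: dist_padic_def padic_norm_minus)
qed

lemma continuous_on_padic_affine: "continuous_on UNIV (\<lambda>t :: 'p::prime_card padic. c * t + a)"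
proof (cases "c = 0")
  case False
  then have "padic_norm c > 0"
    using padic_norm_nonneg[of c] padic_norm_eq_0_iff[of c] by simp
  have "dist (c * t + a) (c * s + a) = padic_norm c * dist t s" for t s
    by (simp add: dist_padic_def flip: padic_norm_mult right_diff_distrib)
  then show ?thesis
    using \<open>padic_norm c > 0\<close>
    by (intro lipschitz_on_continuous_on[where L = "padic_norm c"] lipschitz_onI) auto
qed (simp add: continuous_on_const)

lemma padic_norm_measurable [measurable]: "padic_norm \<in> borel_measurable borel"
  by (rule borel_measurable_continuous_onI[OF continuous_on_padic_norm])

lemma padic_affine_measurable: "(\<lambda>t. c * t + a) \<in> borel \<rightarrow>\<^sub>M (borel :: 'p::prime_card padic measure)"
  by (rule borel_measurable_continuous_onI[OF continuous_on_padic_affine])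

lemma padic_mult_measurable [measurable]: "(*) c \<in> borel \<rightarrow>\<^sub>M (borel :: 'p::prime_card padic measure)"
  using padic_affine_measurable[of c 0] by simp

lemma padic_diff_measurable [measurable]: "(-) a \<in> borel \<rightarrow>\<^sub>M (borel :: 'p::prime_card padic measure)"
  using padic_affine_measurable[of "-1" a] by simp

section \<open>Scaling of Haar measure\<close>

context
  fixes M :: "'p::prime_card padic measure"
  assumes haar: "normalized_Haar M"
begin

lemma haar_sets: "sets M = sets borel"
  using haar by (simp add: normalized_Haar_def)

lemma haar_space: "space M = UNIV"
  using sets_eq_imp_space_eq[OF haar_sets] by simp

lemma haar_cball_translate: "emeasure M (cball a r) = emeasure M (cball 0 r)"
proof -
  have "cball a r = (+) a ` cball 0 r"
  proof (rule set_eqI)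
    fix y
    have "y \<in> (+) a ` cball 0 r \<longleftrightarrow> y - a \<in> cball 0 r"
      by (metis (no_types, lifting) add.commute diff_add_cancel add_diff_cancel_left' imageE image_eqI)
    then show "y \<in> cball a r \<longleftrightarrow> y \<in> (+) a ` cball 0 r"
      using padic_norm_minus_commute[of y a] by (simp add: dist_padic_def)
  qed
  moreover have "cball 0 r \<in> sets M"
    by (simp add: haar_sets)
  moreover have "\<forall>a. \<forall>A\<in>sets M. emeasure M ((+) a ` A) = emeasure M A"
    using haar unfolding normalized_Haar_def by (elim conjE)
  ultimately show ?thesis
    by (simp only:)
qed

text \<open>The larger ball is the disjoint union of p translates of the smaller one.\<close>

lemma haar_cball_Suc:
  "emeasure M (cball 0 (real CARD('p) powi (k + 1))) = of_nat CARD('p) * emeasure M (cball 0 (real CARD('p) powi k))"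
proof -
  have "emeasure M (cball 0 (real CARD('p) powi (k + 1))) =
      (\<Sum>i<CARD('p). emeasure M (cball (0 + of_nat i * of_nat CARD('p) powi (- (k + 1))) (real CARD('p) powi k)))"
    unfolding padic_cball_split(1)[of 0 k]
  proof (rule sum_emeasure[symmetric])
    show "(\<lambda>i. cball (0 + of_nat i * of_nat CARD('p) powi (- (k + 1))) (real CARD('p) powi k)) ` {..<CARD('p)} \<subseteq> sets M"
      unfolding haar_sets by (intro image_subsetI borel_closed closed_cball)
  qed (rule padic_cball_split(2), simp)
  also have "\<dots> = (\<Sum>i<CARD('p). emeasure M (cball 0 (real CARD('p) powi k)))"
    by (intro sum.cong refl haar_cball_translate)
  finally show ?thesis by simp
qed

lemma haar_cball_powi: "emeasure M (cball a (real CARD('p) powi k)) = ennreal (real CARD('p) powi k)"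
proof -
  let ?p = "real CARD('p)"
  have p: "?p > 1" by (rule prime_card_gt_1)
  have "emeasure M (cball 0 (?p powi k)) = ennreal (?p powi k)"
  proof (induction k rule: int_induct[where k = 0])
    case base
    then show ?case using haar by (simp add: normalized_Haar_def padic_cball_0)
  next
    case (step1 i)
    then show ?case
      using p by (simp only: haar_cball_Suc ennreal_of_nat_eq_real_of_nat)
        (simp add: power_int_add mult.commute flip: ennreal_mult')
  next
    case (step2 i)
    \<comment> \<open>Downwards the recursion is solved by cancelling the factor p, which is allowed
      in \<open>ennreal\<close> because it is positive and finite.\<close>
    have "ennreal ?p * emeasure M (cball 0 (?p powi (i - 1))) = ennreal ?p * ennreal (?p powi (i - 1))"
      using step2 haar_cball_Suc[of "i - 1"] p power_int_add[of ?p "i - 1" 1]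
      by (simp add: ennreal_of_nat_eq_real_of_nat mult.commute flip: ennreal_mult')
    then show ?case
      using p by (simp add: ennreal_mult_cancel_left)
  qed
  then show ?thesis by (simp only: haar_cball_translate[of a])
qed

lemma haar_cball_le:
  assumes "r > 0"
  shows "emeasure M (cball a r) \<le> ennreal r"
proof -
  obtain k where k: "real CARD('p) powi k \<le> r"
    "\<And>a :: 'p padic. cball a r = cball a (real CARD('p) powi k)"
    using padic_cball_radius[OF assms, where 'p = 'p] by blast
  have "emeasure M (cball a r) = ennreal (real CARD('p) powi k)"
    unfolding k(2)[of a] by (rule haar_cball_powi)
  then show ?thesis
    using ennreal_leI[OF k(1)] by (simp only:)
qed

text \<open>This is d(ct) = |c| dt. The preimage of a ball under multiplication by \<open>c\<close>
  is a ball with radius divided by \<open>padic_norm c\<close>, and it suffices to compare the two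
  measures on balls.\<close>

lemma haar_scale:
  assumes "c \<noteq> 0"
  shows "M = density (distr M borel ((*) c)) (\<lambda>_. ennreal (padic_norm c))"
proof (rule padic_measure_eqI)
  let ?p = "real CARD('p)"
  have p: "?p > 1" by (rule prime_card_gt_1)
  fix a k
  obtain j where j: "padic_norm c = ?p powi j" using assms by (rule padic_norm_values)
  have "(*) c -` cball a (?p powi k) = cball (a / c) (?p powi (k - j))"
  proof (rule set_eqI)
    fix y
    have "a / c - y = (a - c * y) / c" using assms by (simp add: field_simps)
    then show "y \<in> (*) c -` cball a (?p powi k) \<longleftrightarrow> y \<in> cball (a / c) (?p powi (k - j))"
      using p by (simp add: dist_padic_def padic_norm_divide j power_int_diff field_simps)
  qed
  then have "emeasure (distr M borel ((*) c)) (cball a (?p powi k)) = ennreal (?p powi (k - j))"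
    using haar_sets haar_space
    by (subst emeasure_distr) (simp_all add: haar_cball_powi measurable_cong_sets[OF haar_sets refl])
  then show "emeasure M (cball a (?p powi k)) =
      emeasure (density (distr M borel ((*) c)) (\<lambda>_. ennreal (padic_norm c))) (cball a (?p powi k))"
    using p by (simp add: emeasure_density_const haar_cball_powi j power_int_diff flip: ennreal_mult')
qed (simp_all add: haar_sets haar_cball_powi)

lemma haar_integral_scale:
  fixes h :: "'p padic \<Rightarrow> real"
  assumes "c \<noteq> 0" and [measurable]: "h \<in> borel_measurable borel"
  shows "integral\<^sup>L M h = padic_norm c * (\<integral>t. h (c * t) \<partial>M)"
    and "integrable M h \<longleftrightarrow> integrable M (\<lambda>t. h (c * t))"
proof -
  have [measurable]: "(*) c \<in> M \<rightarrow>\<^sub>M borel"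
    by (simp add: measurable_cong_sets[OF haar_sets refl])
  have nz: "padic_norm c \<noteq> 0" "padic_norm c \<ge> 0"
    using assms(1) by (simp_all add: padic_norm_eq_0_iff padic_norm_nonneg)
  have "integral\<^sup>L M h = integral\<^sup>L (density (distr M borel ((*) c)) (\<lambda>_. ennreal (padic_norm c))) h"
    using haar_scale[OF assms(1)] by simp
  also have "\<dots> = padic_norm c * (\<integral>t. h (c * t) \<partial>M)"
    using nz by (subst integral_density) (auto simp: integral_distr)
  finally show "integral\<^sup>L M h = padic_norm c * (\<integral>t. h (c * t) \<partial>M)" .
  have "integrable M h \<longleftrightarrow> integrable (density (distr M borel ((*) c)) (\<lambda>_. ennreal (padic_norm c))) h"
    using haar_scale[OF assms(1)] by simp
  also have "\<dots> \<longleftrightarrow> integrable M (\<lambda>t. h (c * t))"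
    using nz by (subst integrable_density) (auto simp: integrable_distr_eq)
  finally show "integrable M h \<longleftrightarrow> integrable M (\<lambda>t. h (c * t))" .
qed

end

section \<open>The logarithmic expansion\<close>

text \<open>The remainder is the tail of the binomial series. Once |u|^(K+1) is taken out, what is
  left is dominated by the tail of the absolute series at \<open>r\<close>, uniformly in
  \<open>u\<close>.\<close>

lemma binomial_remainder_bound:
  fixes c r :: real
  assumes "0 < r" "r < 1"
  obtains C where "C \<ge> 0"
    "\<And>u. \<bar>u\<bar> \<le> r \<Longrightarrow> \<bar>(1 + u) powr c - (\<Sum>k\<le>K. (c gchoose k) * u ^ k)\<bar> \<le> C * \<bar>u\<bar> ^ Suc K"
proof -
  define g where "g k = \<bar>c gchoose k\<bar> * r ^ k" for k
  \<comment> \<open>Any point strictly between \<open>r\<close> and 1 would do: convergence there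
    gives absolute convergence at \<open>r\<close>.\<close>
  have "(\<lambda>k. (c gchoose k) * ((1 + r) / 2) ^ k) sums (1 + (1 + r) / 2) powr c"
    using assms by (intro gen_binomial_real) auto
  then have "summable (\<lambda>k. norm ((c gchoose k) * r ^ k))"
    using assms by (intro powser_insidea[of _ "(1 + r) / 2"]) (auto simp: sums_iff)
  then have "summable g"
    using assms by (simp add: g_def[abs_def] abs_mult)
  then have sg: "summable (\<lambda>k. g (k + Suc K))"
    by (rule summable_ignore_initial_segment)
  define C where "C = (\<Sum>k. g (k + Suc K)) / r ^ Suc K"
  show ?thesis
  proof (rule that)
    show "C \<ge> 0"
      unfolding C_def using assms sg by (intro divide_nonneg_nonneg suminf_nonneg) (auto simp: g_def)
    fix u :: real assume u: "\<bar>u\<bar> \<le> r"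
    have S: "(\<lambda>k. (c gchoose k) * u ^ k) sums (1 + u) powr c"
      using u assms by (intro gen_binomial_real) auto
    have "(\<lambda>k. (c gchoose (k + Suc K)) * u ^ (k + Suc K)) sums
        ((1 + u) powr c - (\<Sum>k<Suc K. (c gchoose k) * u ^ k))"
      using S by (subst sums_iff_shift') simp
    then have *: "(1 + u) powr c - (\<Sum>k\<le>K. (c gchoose k) * u ^ k) =
        (\<Sum>k. (c gchoose (k + Suc K)) * u ^ (k + Suc K))"
      by (simp add: sums_iff lessThan_Suc_atMost)
    have bd: "norm ((c gchoose (k + Suc K)) * u ^ (k + Suc K)) \<le> g (k + Suc K) * (\<bar>u\<bar> ^ Suc K / r ^ Suc K)" for k
    proof -
      have "\<bar>u\<bar> ^ k \<le> r ^ k"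
        using u by (intro power_mono) auto
      then have "\<bar>c gchoose (k + Suc K)\<bar> * \<bar>u\<bar> ^ Suc K * \<bar>u\<bar> ^ k \<le> \<bar>c gchoose (k + Suc K)\<bar> * \<bar>u\<bar> ^ Suc K * r ^ k"
        by (intro mult_left_mono) auto
      moreover have "g (k + Suc K) * (\<bar>u\<bar> ^ Suc K / r ^ Suc K) = \<bar>c gchoose (k + Suc K)\<bar> * \<bar>u\<bar> ^ Suc K * r ^ k"
        using assms by (simp add: g_def power_add)
      moreover have "norm ((c gchoose (k + Suc K)) * u ^ (k + Suc K)) = \<bar>c gchoose (k + Suc K)\<bar> * \<bar>u\<bar> ^ Suc K * \<bar>u\<bar> ^ k"
        by (simp add: abs_mult power_abs power_add)
      ultimately show ?thesis by simp
    qed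
    have "norm (\<Sum>k. (c gchoose (k + Suc K)) * u ^ (k + Suc K)) \<le> (\<Sum>k. g (k + Suc K) * (\<bar>u\<bar> ^ Suc K / r ^ Suc K))"
      using bd sg by (intro norm_suminf_le summable_mult2)
    also have "\<dots> = C * \<bar>u\<bar> ^ Suc K"
      unfolding C_def using sg by (subst suminf_mult2[symmetric]) auto
    finally show "\<bar>(1 + u) powr c - (\<Sum>k\<le>K. (c gchoose k) * u ^ k)\<bar> \<le> C * \<bar>u\<bar> ^ Suc K"
      unfolding * by simp
  qed
qed

text \<open>Far from the origin the Taylor polynomial itself is of the order of its remainder, so
  there the function may be replaced by zero.\<close>

lemma truncated_binomial_remainder_bound:
  fixes c r :: real
  assumes "0 < r" "r < 1"
  obtains C where "C \<ge> 0"
    "\<And>u. u \<le> 0 \<Longrightarrow> \<bar>(if - r \<le> u then (1 + u) powr c else 0) - (\<Sum>k\<le>K. (c gchoose k) * u ^ k)\<bar>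
      \<le> C * \<bar>u\<bar> ^ Suc K"
proof -
  obtain C where C: "C \<ge> 0" "\<And>u. \<bar>u\<bar> \<le> r \<Longrightarrow>
      \<bar>(1 + u) powr c - (\<Sum>k\<le>K. (c gchoose k) * u ^ k)\<bar> \<le> C * \<bar>u\<bar> ^ Suc K"
    using binomial_remainder_bound[OF assms, where c = c and K = K] by blast
  \<comment> \<open>Beyond the cut |u|/r exceeds 1, so |u|^k is at most |u|^(K+1) / r^(K+1-k);
    \<open>D\<close> collects these factors.\<close>
  define D where "D = (\<Sum>k\<le>K. \<bar>c gchoose k\<bar> / r ^ (Suc K - k))"
  have D: "D \<ge> 0" unfolding D_def using assms by (intro sum_nonneg) auto
  show ?thesis
  proof (rule that[of "C + D"])
    fix u :: real assume "u \<le> 0"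
    show "\<bar>(if - r \<le> u then (1 + u) powr c else 0) - (\<Sum>k\<le>K. (c gchoose k) * u ^ k)\<bar>
      \<le> (C + D) * \<bar>u\<bar> ^ Suc K"
    proof (cases "- r \<le> u")
      case True
      then have "\<bar>(1 + u) powr c - (\<Sum>k\<le>K. (c gchoose k) * u ^ k)\<bar> \<le> C * \<bar>u\<bar> ^ Suc K"
        using \<open>u \<le> 0\<close> by (intro C) auto
      also have "\<dots> \<le> (C + D) * \<bar>u\<bar> ^ Suc K"
        using D by (intro mult_right_mono) auto
      finally show ?thesis using True by simp
    next
      case False
      have "\<bar>\<Sum>k\<le>K. (c gchoose k) * u ^ k\<bar> \<le> (\<Sum>k\<le>K. \<bar>(c gchoose k) * u ^ k\<bar>)"
        by (rule sum_abs)
      also have "\<dots> \<le> (\<Sum>k\<le>K. \<bar>c gchoose k\<bar> / r ^ (Suc K - k) * \<bar>u\<bar> ^ Suc K)"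
      proof (rule sum_mono)
        fix k assume k: "k \<in> {..K}"
        have "r ^ (Suc K - k) \<le> \<bar>u\<bar> ^ (Suc K - k)"
          using False assms by (intro power_mono) auto
        then have "\<bar>u\<bar> ^ k * 1 \<le> \<bar>u\<bar> ^ k * (\<bar>u\<bar> ^ (Suc K - k) / r ^ (Suc K - k))"
          using assms by (intro mult_left_mono) auto
        also have "\<dots> = \<bar>u\<bar> ^ Suc K / r ^ (Suc K - k)"
          using k by (simp flip: power_add power_Suc)
        finally show "\<bar>(c gchoose k) * u ^ k\<bar> \<le> \<bar>c gchoose k\<bar> / r ^ (Suc K - k) * \<bar>u\<bar> ^ Suc K"
          using mult_left_mono[of "\<bar>u\<bar> ^ k" "\<bar>u\<bar> ^ Suc K / r ^ (Suc K - k)" "\<bar>c gchoose k\<bar>"]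
          by (simp add: abs_mult power_abs)
      qed
      also have "\<dots> = D * \<bar>u\<bar> ^ Suc K"
        unfolding D_def by (rule sum_distrib_right[symmetric])
      also have "\<dots> \<le> (C + D) * \<bar>u\<bar> ^ Suc K"
        using C(1) by (intro mult_right_mono) auto
      finally show ?thesis using False by simp
    qed
  qed (use C D in simp)
qed

text \<open>With m = n - k this turns the convolution in the coefficients into one Taylor polynomial
  for each \<open>a m\<close>.\<close>

lemma sum_antidiagonal:
  fixes N :: nat
  shows "(\<Sum>n\<le>N. \<Sum>k\<le>n. g (n - k) k) = (\<Sum>m\<le>N. \<Sum>k\<le>N - m. g m k)"
proof -
  have "(\<Sum>n\<le>N. \<Sum>k\<le>n. g (n - k) k) = (\<Sum>(n, k)\<in>Sigma {..N} (\<lambda>n. {..n}). g (n - k) k)"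
    by (rule sum.Sigma) auto
  also have "\<dots> = (\<Sum>(m, k)\<in>Sigma {..N} (\<lambda>m. {..N - m}). g m k)"
    by (rule sum.reindex_bij_witness[where i = "\<lambda>(m, k). (m + k, k)" and j = "\<lambda>(n, k). (n - k, k)"])
      auto
  also have "\<dots> = (\<Sum>m\<le>N. \<Sum>k\<le>N - m. g m k)"
    by (rule sum.Sigma[symmetric]) auto
  finally show ?thesis .
qed

text \<open>This is the expansion of the sum of
  \<open>a n * (L + l) powr (\<gamma> - real n)\<close> in powers of l/L, truncated at total order
  \<open>N\<close>. Integrating l^k, with l = ln |t|, against the kernel and |t|^(-\<beta>) gives
  \<open>Omega\<close>, so the inner sums become \<open>expansion_coeff\<close>.\<close>

definition log_expansion :: "(nat \<Rightarrow> real) \<Rightarrow> real \<Rightarrow> nat \<Rightarrow> real \<Rightarrow> real \<Rightarrow> real" where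
  "log_expansion a \<gamma> N L l =
    (\<Sum>n\<le>N. (\<Sum>k\<le>n. a (n - k) * ((\<gamma> + real k - real n) gchoose k) * l ^ k) * L powr (\<gamma> - real n))"

text \<open>The n-th term is expanded only to order N - n. Its remainder, L^(\<gamma>-n) times
  (|l|/L)^(N-n+1), then has the same order L^(\<gamma>-N-1) in \<open>L\<close> for every n.\<close>

lemma log_expansion_bound:
  fixes a :: "nat \<Rightarrow> real" and \<gamma> r :: real
  assumes "0 < r" "r < 1"
  obtains C where "C \<ge> 0"
    "\<And>L l. L \<ge> 1 \<Longrightarrow> l \<le> 0 \<Longrightarrow>
      \<bar>(if - r * L \<le> l then \<Sum>n\<le>N. a n * (L + l) powr (\<gamma> - real n) else 0) -
        log_expansion a \<gamma> N L l\<bar>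
      \<le> C * (1 + \<bar>l\<bar>) ^ Suc N * L powr (\<gamma> - real N - 1)"
proof -
  have "\<exists>C. C \<ge> 0 \<and> (\<forall>u\<le>0. \<bar>(if - r \<le> u then (1 + u) powr (\<gamma> - real n) else 0) -
      (\<Sum>k\<le>N - n. ((\<gamma> - real n) gchoose k) * u ^ k)\<bar> \<le> C * \<bar>u\<bar> ^ Suc (N - n))" for n
    using truncated_binomial_remainder_bound[OF assms, where K = "N - n" and c = "\<gamma> - real n"] by metis
  then obtain C where C: "\<And>n. C n \<ge> 0"
    "\<And>n u. u \<le> 0 \<Longrightarrow> \<bar>(if - r \<le> u then (1 + u) powr (\<gamma> - real n) else 0) -
      (\<Sum>k\<le>N - n. ((\<gamma> - real n) gchoose k) * u ^ k)\<bar> \<le> C n * \<bar>u\<bar> ^ Suc (N - n)"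
    by metis
  show ?thesis
  proof (rule that[of "\<Sum>n\<le>N. \<bar>a n\<bar> * C n"])
    show "(\<Sum>n\<le>N. \<bar>a n\<bar> * C n) \<ge> 0" using C by (intro sum_nonneg) auto
    fix L l :: real assume L: "L \<ge> 1" and l: "l \<le> 0"
    define u where "u = l / L"
    have u: "u \<le> 0" and lu: "l = L * u" using L l by (auto simp: u_def divide_nonpos_pos)
    have if_iff: "- r * L \<le> l \<longleftrightarrow> - r \<le> u"
      using L by (simp add: u_def pos_le_divide_eq)
    \<comment> \<open>The powers of \<open>L\<close> in l^k = L^k u^k compensate the shift of the
      exponent, which leaves a polynomial in \<open>u\<close>.\<close>
    have pw: "L ^ k * L powr (\<gamma> - real (m + k)) = L powr (\<gamma> - real m)" for m k
      using L by (simp add: powr_diff powr_realpow powr_add)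
    have "(\<Sum>n\<le>N. (\<Sum>k\<le>n. a (n - k) * ((\<gamma> + real k - real n) gchoose k) * l ^ k) * L powr (\<gamma> - real n)) =
      (\<Sum>n\<le>N. \<Sum>k\<le>n. (a (n - k) * ((\<gamma> - real (n - k)) gchoose k) * l ^ k) * L powr (\<gamma> - real ((n - k) + k)))"
      unfolding sum_distrib_right by (intro sum.cong refl) (auto simp: of_nat_diff algebra_simps)
    also have "\<dots> = (\<Sum>m\<le>N. \<Sum>k\<le>N - m. (a m * ((\<gamma> - real m) gchoose k) * l ^ k) * L powr (\<gamma> - real (m + k)))"
      by (rule sum_antidiagonal)
    also have "\<dots> = (\<Sum>m\<le>N. a m * L powr (\<gamma> - real m) * (\<Sum>k\<le>N - m. ((\<gamma> - real m) gchoose k) * u ^ k))"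
      unfolding sum_distrib_left lu power_mult_distrib by (intro sum.cong refl) (use pw in simp)
    finally have A: "(\<Sum>n\<le>N. (\<Sum>k\<le>n. a (n - k) * ((\<gamma> + real k - real n) gchoose k) * l ^ k) * L powr (\<gamma> - real n)) = \<dots>" .
    have B: "(if - r * L \<le> l then \<Sum>n\<le>N. a n * (L + l) powr (\<gamma> - real n) else 0) =
        (\<Sum>n\<le>N. a n * L powr (\<gamma> - real n) * (if - r \<le> u then (1 + u) powr (\<gamma> - real n) else 0))"
    proof (cases "- r \<le> u")
      case True
      have "(L + l) powr (\<gamma> - real n) = L powr (\<gamma> - real n) * (1 + u) powr (\<gamma> - real n)" for n
      proof -
        have "L + l = L * (1 + u)" using lu by (simp add: algebra_simps)
        then show ?thesis using L True assms by (simp add: powr_mult)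
      qed
      then show ?thesis unfolding if_iff using True by (simp add: mult.assoc)
    qed (unfold if_iff, simp)
    have "\<bar>(\<Sum>n\<le>N. a n * L powr (\<gamma> - real n) * (if - r \<le> u then (1 + u) powr (\<gamma> - real n) else 0)) -
       (\<Sum>m\<le>N. a m * L powr (\<gamma> - real m) * (\<Sum>k\<le>N - m. ((\<gamma> - real m) gchoose k) * u ^ k))\<bar>
     \<le> (\<Sum>n\<le>N. \<bar>a n * L powr (\<gamma> - real n) * ((if - r \<le> u then (1 + u) powr (\<gamma> - real n) else 0) -
          (\<Sum>k\<le>N - n. ((\<gamma> - real n) gchoose k) * u ^ k))\<bar>)"
      unfolding sum_subtractf[symmetric] right_diff_distrib[symmetric] by (rule sum_abs)
    also have "\<dots> \<le> (\<Sum>n\<le>N. \<bar>a n\<bar> * C n * ((1 + \<bar>l\<bar>) ^ Suc N * L powr (\<gamma> - real N - 1)))"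
    proof (rule sum_mono)
      fix n assume "n \<in> {..N}"
      then have n: "n \<le> N" by simp
      have "L powr (\<gamma> - real n) * \<bar>u\<bar> ^ Suc (N - n) = \<bar>l\<bar> ^ Suc (N - n) * L powr (\<gamma> - real N - 1)"
        using L n pw[of "Suc (N - n)" n]
        by (simp add: lu abs_mult power_mult_distrib of_nat_diff algebra_simps)
      also have "\<dots> \<le> (1 + \<bar>l\<bar>) ^ Suc N * L powr (\<gamma> - real N - 1)"
      proof (rule mult_right_mono)
        \<comment> \<open>The base 1 + |l| is at least 1, so a single power dominates the remainders
          for all n.\<close>
        have "\<bar>l\<bar> ^ Suc (N - n) \<le> (1 + \<bar>l\<bar>) ^ Suc (N - n)" by (intro power_mono) auto
        also have "\<dots> \<le> (1 + \<bar>l\<bar>) ^ Suc N" using n by (intro power_increasing) auto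
        finally show "\<bar>l\<bar> ^ Suc (N - n) \<le> (1 + \<bar>l\<bar>) ^ Suc N" .
      qed simp
      finally have 1: "L powr (\<gamma> - real n) * \<bar>u\<bar> ^ Suc (N - n) \<le> (1 + \<bar>l\<bar>) ^ Suc N * L powr (\<gamma> - real N - 1)" .
      have "\<bar>a n * L powr (\<gamma> - real n) * ((if - r \<le> u then (1 + u) powr (\<gamma> - real n) else 0) -
          (\<Sum>k\<le>N - n. ((\<gamma> - real n) gchoose k) * u ^ k))\<bar> \<le>
          \<bar>a n\<bar> * L powr (\<gamma> - real n) * (C n * \<bar>u\<bar> ^ Suc (N - n))"
        unfolding abs_mult by (intro mult_mono C u) auto
      also have "\<dots> = \<bar>a n\<bar> * C n * (L powr (\<gamma> - real n) * \<bar>u\<bar> ^ Suc (N - n))" by simp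
      also have "\<dots> \<le> \<bar>a n\<bar> * C n * ((1 + \<bar>l\<bar>) ^ Suc N * L powr (\<gamma> - real N - 1))"
        using C(1) by (intro mult_left_mono[OF 1]) auto
      finally show "\<bar>a n * L powr (\<gamma> - real n) * ((if - r \<le> u then (1 + u) powr (\<gamma> - real n) else 0) -
          (\<Sum>k\<le>N - n. ((\<gamma> - real n) gchoose k) * u ^ k))\<bar> \<le> \<dots>" .
    qed
    also have "\<dots> = (\<Sum>n\<le>N. \<bar>a n\<bar> * C n) * (1 + \<bar>l\<bar>) ^ Suc N * L powr (\<gamma> - real N - 1)"
      unfolding sum_distrib_right by (simp only: mult.assoc)
    finally show "\<bar>(if - r * L \<le> l then \<Sum>n\<le>N. a n * (L + l) powr (\<gamma> - real n) else 0) -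
        log_expansion a \<gamma> N L l\<bar>
      \<le> (\<Sum>n\<le>N. \<bar>a n\<bar> * C n) * (1 + \<bar>l\<bar>) ^ Suc N * L powr (\<gamma> - real N - 1)"
      unfolding log_expansion_def A B .
  qed
qed

text \<open>The ratio (L + l)/L lies between 1 - r and 1. The absolute value in the exponent covers
  both signs of \<open>e\<close>, which will be \<gamma> - N.\<close>

lemma powr_comparable:
  fixes e L l r :: real
  assumes "r < 1" "L > 0" "l \<le> 0" "- r * L \<le> l"
  shows "(L + l) powr e \<le> (1 - r) powr (- \<bar>e\<bar>) * L powr e"
proof -
  define v where "v = (L + l) / L"
  have v: "1 - r \<le> v" "v \<le> 1" using assms by (auto simp: v_def field_simps)
  have "v powr e \<le> v powr (- \<bar>e\<bar>)"
    using v assms by (intro powr_mono') auto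
  also have "\<dots> \<le> (1 - r) powr (- \<bar>e\<bar>)"
    using v assms by (intro powr_mono2') auto
  finally have "v powr e * L powr e \<le> (1 - r) powr (- \<bar>e\<bar>) * L powr e"
    by (rule mult_right_mono) simp
  moreover have "v powr e * L powr e = (L + l) powr e"
    using v assms by (simp add: v_def flip: powr_mult)
  ultimately show ?thesis by simp
qed

lemma eventually_powr_le_ln_powr:
  fixes d e c :: real
  assumes "d > 0" "c > 0"
  shows "\<forall>\<^sub>F X in at_top. X powr (- d) \<le> c * ln X powr e"
proof -
  have "(\<lambda>X::real. X powr (- d)) \<in> o(\<lambda>X. ln X powr e)"
    using assms(1) by real_asymp
  from landau_o.smallD[OF this assms(2)] show ?thesis by simp
qed

text \<open>Powers of the logarithm cost an arbitrarily small power of \<open>s\<close>. The rate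
  d/n in the inequality 1 + y \<le> exp y is chosen so that the n-th power yields exactly
  s^(-d).\<close>

lemma ln_power_le_powr:
  fixes s d :: real
  assumes "0 < s" "s \<le> 1" "0 < d"
  shows "(1 + \<bar>ln s\<bar>) ^ n \<le> (1 + real n / d) ^ n * s powr (- d)"
proof (cases "n = 0")
  case True
  then show ?thesis using assms powr_mono'[of "- d" 0 s] by simp
next
  case False
  define v where "v = \<bar>ln s\<bar>"
  have v: "v \<ge> 0" "ln s = - v" using assms by (auto simp: v_def)
  have "1 + v \<le> (1 + real n / d) * (1 + d / real n * v)"
    using assms False v by (simp add: field_simps)
  also have "\<dots> \<le> (1 + real n / d) * exp (d / real n * v)"
    using assms by (intro mult_left_mono exp_ge_add_one_self) auto
  finally have "(1 + v) ^ n \<le> ((1 + real n / d) * exp (d / real n * v)) ^ n"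
    using v by (intro power_mono) auto
  also have "\<dots> = (1 + real n / d) ^ n * s powr (- d)"
    using assms False v by (simp add: power_mult_distrib powr_def flip: exp_of_nat_mult)
  finally show ?thesis by (simp add: v_def)
qed

section \<open>The fractional integral after scaling\<close>

definition frac_kernel :: "real \<Rightarrow> 'p::prime_card padic \<Rightarrow> real" where
  "frac_kernel \<alpha> t = padic_norm (1 - t) powr (\<alpha> - 1) - padic_norm t powr (\<alpha> - 1)"

lemma padic_cball_measurable [measurable]: "cball (a :: 'p::prime_card padic) r \<in> sets borel"
  by simp

lemma frac_kernel_measurable [measurable]: "frac_kernel \<alpha> \<in> borel_measurable borel"
  unfolding frac_kernel_def[abs_def] by measurable

text \<open>By the ultrametric inequality |1 - t| is at most 1, so the kernel is a difference of two
  numbers in the unit interval.\<close>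

lemma abs_frac_kernel_le_1:
  assumes "\<alpha> > 1" "padic_norm t \<le> 1"
  shows "\<bar>frac_kernel \<alpha> t\<bar> \<le> 1"
proof -
  have "padic_norm (1 - t) \<le> 1"
    using padic_norm_diff_le[of 1 t] assms(2) by (simp add: padic_norm_one)
  then have "padic_norm (1 - t) powr (\<alpha> - 1) \<le> 1" "padic_norm t powr (\<alpha> - 1) \<le> 1"
    using assms by (auto intro!: powr_le1 simp: padic_norm_nonneg)
  moreover have "0 \<le> padic_norm (1 - t) powr (\<alpha> - 1)" "0 \<le> padic_norm t powr (\<alpha> - 1)"
    by simp_all
  ultimately show ?thesis unfolding frac_kernel_def by linarith
qed

lemma frac_kernel_scale:
  "padic_norm (x - x * t) powr (\<alpha> - 1) - padic_norm (x * t) powr (\<alpha> - 1) =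
    padic_norm x powr (\<alpha> - 1) * frac_kernel \<alpha> t"
proof -
  have "x - x * t = x * (1 - t)" by (simp add: algebra_simps)
  then have "padic_norm (x - x * t) = padic_norm x * padic_norm (1 - t)"
    by (simp only: padic_norm_mult)
  then show ?thesis
    by (simp add: frac_kernel_def padic_norm_mult powr_mult right_diff_distrib)
qed

lemma indicator_padic_cball_scale:
  fixes x :: "'p::prime_card padic"
  assumes "x \<noteq> 0"
  shows "indicator (cball 0 (padic_norm x)) (x * t) = (indicator (cball 0 1) t :: real)"
proof -
  have "padic_norm x > 0"
    using assms padic_norm_nonneg[of x] padic_norm_eq_0_iff[of x] by simp
  then show ?thesis
    by (simp add: indicator_def padic_cball_0 padic_norm_mult)
qed

lemma eventually_padic_at_infinity:
  "eventually P padic_at_infinity \<longleftrightarrow> (\<exists>R. \<forall>x. padic_norm x \<ge> R \<longrightarrow> P x)"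
  by (auto simp: padic_at_infinity_def eventually_filtercomap eventually_at_top_linorder)

context
  fixes M :: "'p::prime_card padic measure"
  assumes haar: "normalized_Haar M"
begin

section \<open>Integrability on the unit ball and scaling of the integral\<close>

lemma haar_measurable: "borel_measurable M = borel_measurable borel"
  by (rule measurable_cong_sets[OF haar_sets[OF haar] refl])

text \<open>The integrand is dominated by multiples of indicators of the balls of radius p^(-k). The
  k-th one contributes p^(kb) p^(-k) = q^k, a geometric series because b < 1.\<close>

lemma haar_set_integrable_powr:
  assumes "b < 1"
  shows "set_integrable M (cball 0 1) (\<lambda>t. padic_norm t powr (- b))"
  unfolding set_integrable_def
proof (rule integrableI_bounded)
  let ?p = "real CARD('p)"
  have p: "?p > 1" by (rule prime_card_gt_1)
  let ?g = "\<lambda>t :: 'p padic. indicator (cball 0 1) t *\<^sub>R padic_norm t powr (- b)"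
  show "?g \<in> borel_measurable M"
    unfolding haar_measurable by measurable
  define q where "q = ?p powr (b - 1)"
  have q: "0 < q" "q < 1"
    using p assms by (auto simp: q_def powr_less_one)
  \<comment> \<open>If |t| = p^(-k), the k-th term alone equals the integrand and the others only
    add to it. At t = 0 the convention \<open>0 powr a = 0\<close> makes the left side
    vanish.\<close>
  have le: "ennreal (norm (?g t)) \<le>
      (\<Sum>k. ennreal (?p powr (real k * b)) * indicator (cball 0 (?p powi (- int k))) t)" for t
  proof (cases "t = 0 \<or> t \<notin> cball 0 1")
    case True
    then show ?thesis by auto
  next
    case False
    then obtain j where j: "padic_norm t = ?p powi j" using padic_norm_values by blast
    have "?p powi j \<le> 1" using False j by (simp add: padic_cball_0)
    then have "j \<le> 0" using p power_int_strict_increasing[of 0 j ?p] by fastforce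
    then obtain k where k: "j = - int k" by (metis nonpos_int_cases)
    have "padic_norm t powr (- b) = ?p powr (real k * b)"
      using p by (simp add: j k powr_powr flip: powr_real_of_int')
    then have "ennreal (norm (?g t)) =
        ennreal (?p powr (real k * b)) * indicator (cball 0 (?p powi (- int k))) t"
      using False j k by (simp add: padic_cball_0)
    moreover have "w k \<le> suminf w" for w :: "nat \<Rightarrow> ennreal"
      using sum_le_suminf[of w "{k}"] by simp
    ultimately show ?thesis by (simp only:)
  qed
  have "(\<integral>\<^sup>+t. ennreal (norm (?g t)) \<partial>M) \<le>
      (\<integral>\<^sup>+t. (\<Sum>k. ennreal (?p powr (real k * b)) * indicator (cball 0 (?p powi (- int k))) t) \<partial>M)"
    by (rule nn_integral_mono) (rule le)
  also have "\<dots> = (\<Sum>k. \<integral>\<^sup>+t. ennreal (?p powr (real k * b)) * indicator (cball 0 (?p powi (- int k))) t \<partial>M)"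
    by (rule nn_integral_suminf, unfold haar_measurable, measurable)
  also have "\<dots> = (\<Sum>k. ennreal (q ^ k))"
  proof (rule suminf_cong)
    fix k
    have "?p powr (real k * b) * ?p powi (- int k) = q ^ k"
    proof -
      have "?p powi (- int k) = ?p powr (- real k)"
        using p powr_real_of_int'[of ?p "- int k"] by simp
      moreover have "q ^ k = ?p powr (real k * (b - 1))"
        using p by (simp add: q_def powr_powr mult.commute flip: powr_realpow)
      ultimately show ?thesis
        by (simp add: algebra_simps flip: powr_add)
    qed
    then show "(\<integral>\<^sup>+t. ennreal (?p powr (real k * b)) * indicator (cball 0 (?p powi (- int k))) t \<partial>M) = ennreal (q ^ k)"
      using p haar_cball_powi[OF haar, of 0 "- int k"]
      by (subst nn_integral_cmult_indicator) (simp_all add: haar_sets[OF haar] flip: ennreal_mult')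
  qed
  also have "\<dots> < \<infinity>"
  proof -
    have "(\<Sum>k. ennreal (q ^ k)) \<noteq> top"
      using q by (intro ennreal_suminf_neq_top summable_geometric) auto
    then show ?thesis by (simp add: less_top)
  qed
  finally show "(\<integral>\<^sup>+t. ennreal (norm (?g t)) \<partial>M) < \<infinity>" .
qed

text \<open>Half of the gap between \<open>b\<close> and 1 is spent on absorbing the
  logarithms.\<close>

lemma haar_set_integrable_powr_ln:
  assumes "b < 1"
  shows "set_integrable M (cball 0 1) (\<lambda>t. padic_norm t powr (- b) * (1 + \<bar>ln (padic_norm t)\<bar>) ^ n)"
proof -
  define d where "d = (1 - b) / 2"
  have d: "d > 0" "b + d < 1" using assms by (auto simp: d_def field_simps)
  have "set_integrable M (cball 0 1) (\<lambda>t. (1 + real n / d) ^ n * padic_norm t powr (- (b + d)))"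
    by (intro set_integrable_mult_right haar_set_integrable_powr d)
  then show ?thesis
    unfolding set_integrable_def
  proof (rule Bochner_Integration.integrable_bound)
    show "AE t in M. norm (indicator (cball 0 1) t *\<^sub>R (padic_norm t powr (- b) * (1 + \<bar>ln (padic_norm t)\<bar>) ^ n))
        \<le> norm (indicator (cball 0 1) t *\<^sub>R ((1 + real n / d) ^ n * padic_norm t powr (- (b + d))))"
    proof (rule AE_I2)
      fix t
      show "norm (indicator (cball 0 1) t *\<^sub>R (padic_norm t powr (- b) * (1 + \<bar>ln (padic_norm t)\<bar>) ^ n))
        \<le> norm (indicator (cball 0 1) t *\<^sub>R ((1 + real n / d) ^ n * padic_norm t powr (- (b + d))))"
      proof (cases "t = 0 \<or> t \<notin> cball 0 1")
        case False
        then have t: "0 < padic_norm t" "padic_norm t \<le> 1"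
          using padic_norm_nonneg[of t] padic_norm_eq_0_iff[of t] by (auto simp: padic_cball_0)
        have "padic_norm t powr (- b) * (1 + \<bar>ln (padic_norm t)\<bar>) ^ n \<le>
            padic_norm t powr (- b) * ((1 + real n / d) ^ n * padic_norm t powr (- d))"
          using t d by (intro mult_left_mono ln_power_le_powr) auto
        also have "\<dots> = (1 + real n / d) ^ n * padic_norm t powr (- (b + d))"
          by (simp add: powr_add algebra_simps flip: powr_add)
        finally show ?thesis using d False by simp
      qed auto
    qed
  qed (unfold haar_measurable, measurable)
qed

lemma integrable_frac_kernel_mult:
  assumes "\<alpha> > 1" "set_integrable M (cball 0 1) g"
  shows "set_integrable M (cball 0 1) (\<lambda>t. frac_kernel \<alpha> t * g t)"
  unfolding set_integrable_def
proof (rule Bochner_Integration.integrable_bound)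
  show "integrable M (\<lambda>t. indicator (cball 0 1) t *\<^sub>R g t)"
    using assms(2) by (simp add: set_integrable_def)
  then have [measurable]: "(\<lambda>t. indicator (cball 0 1) t *\<^sub>R g t) \<in> borel_measurable borel"
    using borel_measurable_integrable haar_measurable by blast
  \<comment> \<open>Measurability of \<open>g\<close> is known only after multiplication by the
    indicator, hence the regrouping.\<close>
  have "(\<lambda>t. indicator (cball 0 1) t *\<^sub>R (frac_kernel \<alpha> t * g t)) =
      (\<lambda>t. frac_kernel \<alpha> t * (indicator (cball 0 1) t *\<^sub>R g t))" by (simp add: algebra_simps)
  also have "\<dots> \<in> borel_measurable M"
    unfolding haar_measurable by measurable
  finally show "(\<lambda>t. indicator (cball 0 1) t *\<^sub>R (frac_kernel \<alpha> t * g t)) \<in> borel_measurable M" .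
  show "AE t in M. norm (indicator (cball 0 1) t *\<^sub>R (frac_kernel \<alpha> t * g t)) \<le> norm (indicator (cball 0 1) t *\<^sub>R g t)"
  proof (rule AE_I2)
    fix t
    show "norm (indicator (cball 0 1) t *\<^sub>R (frac_kernel \<alpha> t * g t)) \<le> norm (indicator (cball 0 1) t *\<^sub>R g t)"
      using mult_right_mono[OF abs_frac_kernel_le_1[OF assms(1), of t], of "\<bar>g t\<bar>"]
      by (auto simp: indicator_def padic_cball_0 abs_mult)
  qed
qed

lemma locally_integrable_cball:
  "locally_integrable M f \<Longrightarrow> set_integrable M (cball a r) f"
  by (simp add: locally_integrable_def compact_padic_cball)

lemma set_integral_padic_scale:
  fixes h :: "'p padic \<Rightarrow> real"
  assumes "x \<noteq> 0" "set_integrable M (cball 0 (padic_norm x)) h"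
  shows "set_integrable M (cball 0 1) (\<lambda>t. h (x * t))"
    and "(LINT y:cball 0 (padic_norm x)|M. h y) = padic_norm x * (LINT t:cball 0 1|M. h (x * t))"
proof -
  let ?g = "\<lambda>y. indicator (cball 0 (padic_norm x)) y *\<^sub>R h y"
  have g: "integrable M ?g" using assms(2) by (simp add: set_integrable_def)
  then have m: "?g \<in> borel_measurable borel"
    using borel_measurable_integrable haar_measurable by blast
  have eq: "?g (x * t) = indicator (cball 0 1) t *\<^sub>R h (x * t)" for t
    by (simp add: indicator_padic_cball_scale[OF assms(1)])
  show "set_integrable M (cball 0 1) (\<lambda>t. h (x * t))"
    using haar_integral_scale(2)[OF haar assms(1) m] g unfolding eq set_integrable_def by (simp only:)
  show "(LINT y:cball 0 (padic_norm x)|M. h y) = padic_norm x * (LINT t:cball 0 1|M. h (x * t))"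
    using haar_integral_scale(1)[OF haar assms(1) m] unfolding eq set_lebesgue_integral_def .
qed

text \<open>The substitution y = xt produces one factor |x| from the measure and |x|^(\<alpha>-1)
  from the homogeneity of the kernel.\<close>

lemma frac_integral_eq:
  assumes "locally_integrable M f" "x \<noteq> 0"
  shows "frac_integral M \<alpha> f x = frac_const CARD('p) \<alpha> *
    (padic_norm x powr \<alpha> * (LINT t:cball 0 1|M. frac_kernel \<alpha> t * f (x * t)))"
proof -
  have pos: "padic_norm x > 0"
    using assms padic_norm_nonneg[of x] padic_norm_eq_0_iff[of x] by simp
  have f: "set_integrable M (cball 0 (padic_norm x)) f"
    by (rule locally_integrable_cball[OF assms(1)])
  have [measurable]: "(\<lambda>y. indicator (cball 0 (padic_norm x)) y *\<^sub>R f y) \<in> borel_measurable borel"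
    using f borel_measurable_integrable haar_measurable unfolding set_integrable_def by blast
  let ?K = "\<lambda>y. padic_norm (x - y) powr (\<alpha> - 1) - padic_norm y powr (\<alpha> - 1)"
  have "(\<lambda>y. indicator (cball 0 (padic_norm x)) y *\<^sub>R (?K y * f y)) =
      (\<lambda>y. ?K y * (indicator (cball 0 (padic_norm x)) y *\<^sub>R f y))" by (simp add: algebra_simps)
  also have "\<dots> \<in> borel_measurable borel" by measurable
  finally have m: "(\<lambda>y. indicator (cball 0 (padic_norm x)) y *\<^sub>R (?K y * f y)) \<in> borel_measurable borel" .
  have "(LINT y:cball 0 (padic_norm x)|M. ?K y * f y) =
      padic_norm x * (\<integral>t. indicator (cball 0 (padic_norm x)) (x * t) *\<^sub>R (?K (x * t) * f (x * t)) \<partial>M)"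
    unfolding set_lebesgue_integral_def by (rule haar_integral_scale(1)[OF haar assms(2) m])
  also have "\<dots> = padic_norm x * (LINT t:cball 0 1|M. padic_norm x powr (\<alpha> - 1) * (frac_kernel \<alpha> t * f (x * t)))"
    unfolding set_lebesgue_integral_def frac_kernel_scale indicator_padic_cball_scale[OF assms(2)] mult.assoc ..
  also have "\<dots> = padic_norm x powr \<alpha> * (LINT t:cball 0 1|M. frac_kernel \<alpha> t * f (x * t))"
    using pos by (simp add: powr_diff)
  finally show ?thesis
    unfolding frac_integral_def padic_cball_0 by simp
qed

text \<open>Local integrability handles the ball of radius \<open>R\<close>. Outside it the
  integrand is at most \<open>Y\<close>, on a ball of measure at most \<open>Y\<close>.\<close>

lemma set_integral_cball_le:
  assumes "locally_integrable M f" "\<And>y. f y \<ge> 0" "\<And>y. padic_norm y \<ge> R \<Longrightarrow> f y \<le> padic_norm y" "Y > 0"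
  shows "(LINT y:cball 0 Y|M. f y) \<le> (LINT y:cball 0 R|M. f y) + Y\<^sup>2"
proof -
  have fin: "emeasure M (cball 0 Y) \<le> ennreal Y"
    by (rule haar_cball_le[OF haar assms(4)])
  then have fin': "emeasure M (cball 0 Y) < \<infinity>"
    using le_less_trans ennreal_less_top by fastforce
  have meas: "measure M (cball 0 Y) \<le> Y"
    using fin assms(4) by (simp add: measure_def enn2real_leI)
  have sets: "cball 0 Y \<in> sets M" by (simp add: haar_sets[OF haar])
  have i1: "integrable M (\<lambda>y. indicator (cball 0 R) y *\<^sub>R f y)" "integrable M (\<lambda>y. indicator (cball 0 Y) y *\<^sub>R f y)"
    using locally_integrable_cball[OF assms(1)] by (auto simp: set_integrable_def)
  have i2: "integrable M (\<lambda>y. Y * indicator (cball 0 Y) y)"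
    using sets fin' by (intro integrable_mult_right integrable_real_indicator)
  have "(LINT y:cball 0 Y|M. f y) \<le> (\<integral>y. indicator (cball 0 R) y *\<^sub>R f y + Y * indicator (cball 0 Y) y \<partial>M)"
    unfolding set_lebesgue_integral_def
  proof (rule integral_mono)
    fix y
    show "indicator (cball 0 Y) y *\<^sub>R f y \<le> indicator (cball 0 R) y *\<^sub>R f y + Y * indicator (cball 0 Y) y"
      using assms(2)[of y] assms(3)[of y] assms(4) by (auto simp: indicator_def padic_cball_0)
  qed (use i1 i2 in auto)
  also have "\<dots> = (LINT y:cball 0 R|M. f y) + Y * measure M (cball 0 Y)"
    using i1 i2 sets by (simp add: set_lebesgue_integral_def)
  also have "Y * measure M (cball 0 Y) \<le> Y * Y"
    using meas assms(4) by (intro mult_left_mono) auto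
  finally show ?thesis by (simp add: power2_eq_square)
qed

text \<open>Each monomial in the logarithm is integrable against the kernel, so the rest is
  linearity. The free \<open>c\<close> and \<open>w\<close> stand for the binomial coefficients
  times \<open>a\<close> and for the powers of ln |x|.\<close>

lemma Omega_expansion:
  assumes "\<alpha> > 1" "\<beta> < 1"
  shows "set_integrable M (cball 0 1) (\<lambda>t. frac_kernel \<alpha> t * (padic_norm t powr (- \<beta>) *
        (\<Sum>n\<le>N. (\<Sum>k\<le>n. c n k * ln (padic_norm t) ^ k) * w n)))" (is "set_integrable M _ ?g")
    and "(LINT t:cball 0 1|M. frac_kernel \<alpha> t * (padic_norm t powr (- \<beta>) *
        (\<Sum>n\<le>N. (\<Sum>k\<le>n. c n k * ln (padic_norm t) ^ k) * w n))) =
      (\<Sum>n\<le>N. (\<Sum>k\<le>n. c n k * Omega M k \<alpha> \<beta>) * w n)"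
proof -
  define W where "W k t = indicator (cball 0 1) t *\<^sub>R
    (frac_kernel \<alpha> t * (padic_norm t powr (- \<beta>) * ln (padic_norm t) ^ k))" for k and t :: "'p padic"
  have W: "integrable M (W k)" for k
  proof -
    have "set_integrable M (cball 0 1) (\<lambda>t. padic_norm t powr (- \<beta>) * ln (padic_norm t) ^ k)"
      using haar_set_integrable_powr_ln[OF assms(2), of k] unfolding set_integrable_def
    proof (rule Bochner_Integration.integrable_bound)
      show "AE t in M. norm (indicator (cball 0 1) t *\<^sub>R (padic_norm t powr (- \<beta>) * ln (padic_norm t) ^ k))
          \<le> norm (indicator (cball 0 1) t *\<^sub>R (padic_norm t powr (- \<beta>) * (1 + \<bar>ln (padic_norm t)\<bar>) ^ k))"
        by (rule AE_I2) (auto simp: abs_mult power_abs indicator_def intro!: mult_left_mono power_mono)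
    qed (unfold haar_measurable, measurable)
    then show ?thesis
      using integrable_frac_kernel_mult[OF assms(1)] by (simp add: set_integrable_def W_def[abs_def])
  qed
  have Om: "Omega M k \<alpha> \<beta> = integral\<^sup>L M (W k)" for k
    by (simp add: Omega_def set_lebesgue_integral_def padic_cball_0 frac_kernel_def mult.assoc W_def[abs_def])
  have eq: "indicator (cball 0 1) t *\<^sub>R ?g t = (\<Sum>n\<le>N. \<Sum>k\<le>n. (c n k * w n) * W k t)" for t
    by (simp add: sum_distrib_left sum_distrib_right mult_ac W_def)
  show "set_integrable M (cball 0 1) ?g"
    unfolding set_integrable_def eq
    by (intro Bochner_Integration.integrable_sum integrable_mult_right W)
  have "(LINT t:cball 0 1|M. ?g t) = (\<Sum>n\<le>N. \<Sum>k\<le>n. (c n k * w n) * integral\<^sup>L M (W k))"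
    unfolding set_lebesgue_integral_def eq by (simp add: Bochner_Integration.integral_sum W)
  then show "(LINT t:cball 0 1|M. ?g t) = (\<Sum>n\<le>N. (\<Sum>k\<le>n. c n k * Omega M k \<alpha> \<beta>) * w n)"
    by (simp add: Om sum_distrib_left sum_distrib_right mult_ac)
qed

end

section \<open>Error estimates\<close>

text \<open>Below the cut no expansion of \<open>f\<close> is available, so the first error term
  keeps \<open>f\<close> itself. The second combines the error \<epsilon> of the hypothesis, with L
  + l replaced by L at the price of a power of 1 - r, and the Taylor remainder C/L.\<close>

lemma scaled_expansion_error:
  fixes f :: "'p::prime_card padic \<Rightarrow> real"
  assumes r: "0 < r" "r < 1" and L: "ln (padic_norm x) \<ge> 1"
    and f0: "\<And>y. f y \<ge> 0"
    and f: "\<And>y. padic_norm y \<ge> R \<Longrightarrow>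
        \<bar>f y - padic_norm y powr (- \<beta>) * (\<Sum>n\<le>N. a n * ln (padic_norm y) powr (\<gamma> - real n))\<bar>
        \<le> \<epsilon> * (padic_norm y powr (- \<beta>) * ln (padic_norm y) powr (\<gamma> - real N))"
    and \<epsilon>: "\<epsilon> \<ge> 0" and R: "R \<le> padic_norm x powr (1 - r)"
    and C: "C \<ge> 0" "\<And>L l. L \<ge> 1 \<Longrightarrow> l \<le> 0 \<Longrightarrow>
      \<bar>(if - r * L \<le> l then \<Sum>n\<le>N. a n * (L + l) powr (\<gamma> - real n) else 0) - log_expansion a \<gamma> N L l\<bar>
      \<le> C * (1 + \<bar>l\<bar>) ^ Suc N * L powr (\<gamma> - real N - 1)"
    and t: "padic_norm t \<le> 1"
  shows "\<bar>padic_norm x powr \<beta> * f (x * t) -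
        padic_norm t powr (- \<beta>) * log_expansion a \<gamma> N (ln (padic_norm x)) (ln (padic_norm t))\<bar>
    \<le> padic_norm x powr \<beta> * (indicator (cball 0 (padic_norm x powr (1 - r))) (x * t) * f (x * t)) +
      ln (padic_norm x) powr (\<gamma> - real N) * (\<epsilon> * (1 - r) powr (- \<bar>\<gamma> - real N\<bar>) + C / ln (padic_norm x)) *
      (padic_norm t powr (- \<beta>) * (1 + \<bar>ln (padic_norm t)\<bar>) ^ Suc N)"
proof (cases "t = 0")
  case True
  \<comment> \<open>At t = 0 the factor \<open>0 powr (- \<beta>)\<close> is 0 and hides
    \<open>ln 0\<close>; what remains is \<open>f 0\<close>, which the indicator term
    contains.\<close>
  then show ?thesis using f0[of 0] by (simp add: indicator_def padic_cball_0)
next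
  case False
  define X where "X = padic_norm x"
  define s where "s = padic_norm t"
  define L where "L = ln X"
  define l where "l = ln s"
  define P where "P = log_expansion a \<gamma> N L l"
  define D where "D = (1 - r) powr (- \<bar>\<gamma> - real N\<bar>)"
  define v where "v = (1 + \<bar>l\<bar>) ^ Suc N"
  have L1: "L \<ge> 1" using L by (simp add: L_def X_def)
  have X: "X > 1" 
  proof (rule ccontr)
    assume "\<not> X > 1"
    then have "ln X \<le> 0" using padic_norm_nonneg[of x] by (cases "X = 0") (auto simp: X_def)
    then show False using L1 by (simp add: L_def)
  qed
  have s: "0 < s" "s \<le> 1"
    using t False padic_norm_nonneg[of t] padic_norm_eq_0_iff[of t] by (simp_all add: s_def)
  have l: "l \<le> 0" using s by (simp add: l_def)
  have v: "v \<ge> 1" unfolding v_def by (rule one_le_power) simp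
  have D: "D \<ge> 0" by (simp add: D_def)
  have xt: "padic_norm (x * t) = X * s" by (simp add: padic_norm_mult X_def s_def)
  have lnxt: "ln (X * s) = L + l" using X s by (simp add: ln_mult L_def l_def)
  have "- r * L \<le> l \<longleftrightarrow> ln (X powr (1 - r)) \<le> ln (X * s)"
    using X by (auto simp: lnxt ln_powr L_def algebra_simps)
  also have "\<dots> \<longleftrightarrow> X powr (1 - r) \<le> X * s"
    using X s by (intro ln_le_cancel_iff) auto
  finally have near: "- r * L \<le> l \<longleftrightarrow> X powr (1 - r) \<le> X * s" .
  have Cl: "\<bar>(if - r * L \<le> l then \<Sum>n\<le>N. a n * (L + l) powr (\<gamma> - real n) else 0) - P\<bar>
      \<le> L powr (\<gamma> - real N) * (C / L) * v"
    using C(2)[OF L1 l] L1 by (simp add: P_def v_def powr_diff mult_ac)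
  have Xs: "X powr \<beta> * (X * s) powr (- \<beta>) = s powr (- \<beta>)"
    using X s by (simp add: powr_mult flip: powr_add mult.assoc)
  have "\<bar>X powr \<beta> * f (x * t) - s powr (- \<beta>) * P\<bar> \<le>
      X powr \<beta> * (indicator (cball 0 (X powr (1 - r))) (x * t) * f (x * t)) +
      L powr (\<gamma> - real N) * (\<epsilon> * D + C / L) * (s powr (- \<beta>) * v)"
  proof (cases "- r * L \<le> l")
    case True
    define g where "g = (\<Sum>n\<le>N. a n * (L + l) powr (\<gamma> - real n))"
    have "\<bar>f (x * t) - (X * s) powr (- \<beta>) * g\<bar> \<le> \<epsilon> * ((X * s) powr (- \<beta>) * (L + l) powr (\<gamma> - real N))"
    proof -
      have "R \<le> padic_norm (x * t)"
        using R True near unfolding xt X_def by simp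
      from f[OF this] show ?thesis
        unfolding xt lnxt g_def by simp
    qed
    then have "X powr \<beta> * \<bar>f (x * t) - (X * s) powr (- \<beta>) * g\<bar> \<le>
        X powr \<beta> * (\<epsilon> * ((X * s) powr (- \<beta>) * (L + l) powr (\<gamma> - real N)))"
      by (rule mult_left_mono) simp
    also have "\<dots> = (X powr \<beta> * (X * s) powr (- \<beta>)) * (\<epsilon> * (L + l) powr (\<gamma> - real N))" by simp
    also have "\<dots> \<le> s powr (- \<beta>) * (\<epsilon> * (D * L powr (\<gamma> - real N) * v))"
    proof -
      have "(L + l) powr (\<gamma> - real N) \<le> D * L powr (\<gamma> - real N)"
        unfolding D_def using r L1 l True by (intro powr_comparable) auto
      also have "\<dots> \<le> D * L powr (\<gamma> - real N) * v"
        using mult_left_mono[OF v, of "D * L powr (\<gamma> - real N)"] D by simp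
      finally show ?thesis unfolding Xs using \<epsilon> by (intro mult_left_mono) auto
    qed
    finally have 1: "X powr \<beta> * \<bar>f (x * t) - (X * s) powr (- \<beta>) * g\<bar> \<le>
        s powr (- \<beta>) * (\<epsilon> * (D * L powr (\<gamma> - real N) * v))" .
    have 2: "s powr (- \<beta>) * \<bar>g - P\<bar> \<le> s powr (- \<beta>) * (L powr (\<gamma> - real N) * (C / L) * v)"
      using Cl True by (intro mult_left_mono) (simp_all add: g_def)
    \<comment> \<open>The error is split at \<open>g\<close>, the given expansion of
      \<open>f\<close> before it is developed in powers of l/L.\<close>
    have "X powr \<beta> * f (x * t) - s powr (- \<beta>) * P =
        X powr \<beta> * (f (x * t) - (X * s) powr (- \<beta>) * g) + s powr (- \<beta>) * (g - P)"
      unfolding right_diff_distrib mult.assoc[symmetric] Xs by simp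
    then have "\<bar>X powr \<beta> * f (x * t) - s powr (- \<beta>) * P\<bar> \<le>
        X powr \<beta> * \<bar>f (x * t) - (X * s) powr (- \<beta>) * g\<bar> + s powr (- \<beta>) * \<bar>g - P\<bar>"
      using abs_triangle_ineq[of "X powr \<beta> * (f (x * t) - (X * s) powr (- \<beta>) * g)" "s powr (- \<beta>) * (g - P)"]
      by (simp add: abs_mult)
    also have "\<dots> \<le> s powr (- \<beta>) * (\<epsilon> * (D * L powr (\<gamma> - real N) * v)) +
        s powr (- \<beta>) * (L powr (\<gamma> - real N) * (C / L) * v)"
      using 1 2 by (rule add_mono)
    also have "\<dots> = 0 + L powr (\<gamma> - real N) * (\<epsilon> * D + C / L) * (s powr (- \<beta>) * v)"
      by (simp add: algebra_simps)
    also have "\<dots> \<le> X powr \<beta> * (indicator (cball 0 (X powr (1 - r))) (x * t) * f (x * t)) +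
      L powr (\<gamma> - real N) * (\<epsilon> * D + C / L) * (s powr (- \<beta>) * v)"
      using f0 by (intro add_right_mono mult_nonneg_nonneg) auto
    finally show ?thesis .
  next
    case False
    then have ind: "indicator (cball 0 (X powr (1 - r))) (x * t) = (1 :: real)"
      using near xt by (simp add: padic_cball_0 indicator_def)
    have "\<bar>X powr \<beta> * f (x * t) - s powr (- \<beta>) * P\<bar> \<le> X powr \<beta> * f (x * t) + s powr (- \<beta>) * \<bar>P\<bar>"
      using abs_triangle_ineq4[of "X powr \<beta> * f (x * t)" "s powr (- \<beta>) * P"] f0[of "x * t"]
      by (simp add: abs_mult)
    also have "s powr (- \<beta>) * \<bar>P\<bar> \<le> s powr (- \<beta>) * (L powr (\<gamma> - real N) * (\<epsilon> * D + C / L) * v)"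
    proof (rule mult_left_mono)
      \<comment> \<open>Below the cut the truncated function is 0, so the remainder bound is a bound
        for \<open>P\<close> itself.\<close>
      have "\<bar>P\<bar> \<le> L powr (\<gamma> - real N) * (C / L) * v" using Cl False by simp
      also have "\<dots> \<le> L powr (\<gamma> - real N) * (\<epsilon> * D + C / L) * v"
        using \<epsilon> D v by (intro mult_right_mono mult_left_mono) auto
      finally show "\<bar>P\<bar> \<le> L powr (\<gamma> - real N) * (\<epsilon> * D + C / L) * v" .
    qed simp
    finally show ?thesis unfolding ind by (simp add: mult_ac)
  qed
  then show ?thesis by (simp only: X_def s_def L_def l_def P_def D_def v_def)
qed

text \<open>The leading term alone gives a bound by a multiple of |x|^(-\<beta>) (ln |x|)^\<gamma>,
  and since \<beta> \<ge> 0 this is eventually below |x|.\<close>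

lemma padic_expansion_le_norm:
  fixes f :: "'p::prime_card padic \<Rightarrow> real"
  assumes "0 \<le> \<beta>"
    and "(\<lambda>x. f x - padic_norm x powr (- \<beta>) * (a * ln (padic_norm x) powr \<gamma>))
      \<in> o[padic_at_infinity](\<lambda>x. padic_norm x powr (- \<beta>) * ln (padic_norm x) powr \<gamma>)"
  obtains R where "\<And>x. padic_norm x \<ge> R \<Longrightarrow> f x \<le> padic_norm x"
proof -
  have 1: "\<forall>\<^sub>F x in padic_at_infinity. norm (f x - padic_norm x powr (- \<beta>) * (a * ln (padic_norm x) powr \<gamma>)) \<le>
     1 * norm (padic_norm x powr (- \<beta>) * ln (padic_norm x) powr \<gamma>)"
    by (rule landau_o.smallD[OF assms(2)]) simp
  \<comment> \<open>In \<open>\<bar>a\<bar> + 1\<close> the first summand bounds the leading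
    coefficient and the 1 pays for the little-o error.\<close>
  have "\<forall>\<^sub>F X in at_top. X powr (- 1) \<le> inverse (\<bar>a\<bar> + 1) * ln X powr (- \<gamma>)"
    by (rule eventually_powr_le_ln_powr) auto
  with eventually_gt_at_top[of "1 :: real"]
  have "\<forall>\<^sub>F X in at_top. X powr (- \<beta>) * ((\<bar>a\<bar> + 1) * ln X powr \<gamma>) \<le> X"
  proof eventually_elim
    case (elim X)
    have X: "X > 1" by (rule elim(1))
    have "inverse X \<le> inverse ((\<bar>a\<bar> + 1) * ln X powr \<gamma>)"
      using elim(2) X by (simp add: powr_minus)
    then have "(\<bar>a\<bar> + 1) * ln X powr \<gamma> \<le> X"
      by (rule inverse_le_imp_le) (use X in \<open>auto intro!: mult_pos_pos\<close>)
    moreover have "X powr (- \<beta>) \<le> 1" using X assms(1) powr_mono[of "- \<beta>" 0 X] by simp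
    ultimately show ?case
      using mult_mono[of "X powr (- \<beta>)" 1 "(\<bar>a\<bar> + 1) * ln X powr \<gamma>" X] X by simp
  qed
  then have 2: "\<forall>\<^sub>F x :: 'p padic in padic_at_infinity.
      padic_norm x powr (- \<beta>) * ((\<bar>a\<bar> + 1) * ln (padic_norm x) powr \<gamma>) \<le> padic_norm x"
    unfolding padic_at_infinity_def by (rule eventually_filtercomapI)
  from 1 2 have "\<forall>\<^sub>F x in padic_at_infinity. f x \<le> padic_norm x"
  proof eventually_elim
    case (elim x)
    let ?w = "padic_norm x powr (- \<beta>) * ln (padic_norm x) powr \<gamma>"
    have "f x \<le> a * ?w + ?w" using elim(1) by (simp add: abs_le_iff algebra_simps)
    also have "\<dots> \<le> \<bar>a\<bar> * ?w + ?w" by (intro add_right_mono mult_right_mono) auto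
    also have "\<dots> \<le> padic_norm x" using elim(2) by (simp add: algebra_simps)
    finally show ?case .
  qed
  then show ?thesis using that unfolding eventually_padic_at_infinity by blast
qed

lemma eventually_powr_bounds:
  fixes c d R :: real
  assumes "c > 0" "d > 0" "e > 0"
  shows "\<forall>\<^sub>F X in at_top. ln X \<ge> 1 \<and> X > 1 \<and> X powr d \<ge> R \<and> K / ln X \<le> c \<and> B * X powr (- e) \<le> c * ln X powr s"
proof -
  have 1: "filterlim (\<lambda>X::real. X powr d) at_top at_top" using assms by real_asymp
  have 2: "filterlim (\<lambda>X::real. ln X) at_top at_top" by real_asymp
  have 3: "((\<lambda>X::real. K / ln X) \<longlongrightarrow> 0) at_top" by real_asymp
  have 4: "\<forall>\<^sub>F X in at_top. X powr (- e) \<le> (c / (\<bar>B\<bar> + 1)) * ln X powr s"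
    using assms by (intro eventually_powr_le_ln_powr) auto
  from 1 have "\<forall>\<^sub>F X in at_top. X powr d \<ge> R" by (simp add: filterlim_at_top)
  moreover from 2 have "\<forall>\<^sub>F X::real in at_top. ln X \<ge> 1" by (simp add: filterlim_at_top)
  moreover from 3 have "\<forall>\<^sub>F X in at_top. K / ln X < c" using assms(1) by (rule order_tendstoD)
  ultimately show ?thesis using 4 eventually_gt_at_top[of 1]
  proof eventually_elim
    case (elim X)
    have "B * X powr (- e) \<le> (\<bar>B\<bar> + 1) * X powr (- e)" by (intro mult_right_mono) auto
    also have "\<dots> \<le> (\<bar>B\<bar> + 1) * ((c / (\<bar>B\<bar> + 1)) * ln X powr s)"
      using elim(4) by (intro mult_left_mono) auto
    also have "\<dots> = c * ln X powr s" by (simp add: field_simps)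
    finally show ?case using elim by simp
  qed
qed

context
  fixes M :: "'p::prime_card padic measure"
  assumes haar: "normalized_Haar M"
begin

text \<open>The kernel is at most 1 in absolute value, so the pointwise error can be integrated.
  Undoing the scaling turns the indicator term into the integral of \<open>f\<close> over the ball
  of radius |x|^(1-r), where the crude bound for \<open>f\<close> applies.\<close>

lemma scaled_integral_error:
  fixes f :: "'p padic \<Rightarrow> real"
  assumes li: "locally_integrable M f" and \<alpha>: "\<alpha> > 1" and \<beta>: "\<beta> < 1"
    and r: "0 < r" "r < 1" and L: "ln (padic_norm x) \<ge> 1" and X: "padic_norm x > 1"
    and f0: "\<And>y. f y \<ge> 0"
    and fR: "\<And>y. padic_norm y \<ge> R0 \<Longrightarrow> f y \<le> padic_norm y"
    and err: "\<And>t. padic_norm t \<le> 1 \<Longrightarrow>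
      \<bar>padic_norm x powr \<beta> * f (x * t) - padic_norm t powr (- \<beta>) * log_expansion a \<gamma> N (ln (padic_norm x)) (ln (padic_norm t))\<bar>
    \<le> padic_norm x powr \<beta> * (indicator (cball 0 (padic_norm x powr (1 - r))) (x * t) * f (x * t)) +
      E * (padic_norm t powr (- \<beta>) * (1 + \<bar>ln (padic_norm t)\<bar>) ^ Suc N)"
  shows "\<bar>padic_norm x powr \<beta> * (LINT t:cball 0 1|M. frac_kernel \<alpha> t * f (x * t)) -
        (\<Sum>n\<le>N. expansion_coeff M a \<alpha> \<beta> \<gamma> n * ln (padic_norm x) powr (\<gamma> - real n))\<bar>
    \<le> padic_norm x powr (\<beta> - 1) * ((LINT y:cball 0 R0|M. f y) + padic_norm x powr (2 * (1 - r))) +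
      E * (LINT t:cball 0 1|M. padic_norm t powr (- \<beta>) * (1 + \<bar>ln (padic_norm t)\<bar>) ^ Suc N)"
proof -
  define X where "X = padic_norm x"
  define Y where "Y = X powr (1 - r)"
  define H where "H t = padic_norm t powr (- \<beta>) * (1 + \<bar>ln (padic_norm t)\<bar>) ^ Suc N" for t :: "'p padic"
  define P where "P t = padic_norm t powr (- \<beta>) * log_expansion a \<gamma> N (ln X) (ln (padic_norm t))" for t :: "'p padic"
  define h where "h y = indicator (cball 0 Y) y * f y" for y
  have X1: "X > 1" using X by (simp add: X_def)
  have x0: "x \<noteq> 0" using X by auto
  have Y: "Y > 0" "Y \<le> X" using X1 r powr_mono[of "1 - r" 1 X] by (auto simp: Y_def)
  have iH: "set_integrable M (cball 0 1) H"
    unfolding H_def[abs_def] by (rule haar_set_integrable_powr_ln[OF haar \<beta>])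
  \<comment> \<open>The small ball lies inside the ball of radius \<open>X\<close>, so the cutoff
    survives the change of variables.\<close>
  have hY: "indicator (cball 0 X) y *\<^sub>R h y = indicator (cball 0 Y) y *\<^sub>R f y" for y
    using Y(2) by (auto simp: h_def indicator_def)
  have ih: "set_integrable M (cball 0 (padic_norm x)) h"
    using locally_integrable_cball[OF haar li, of 0 Y] unfolding set_integrable_def X_def[symmetric] hY .
  note ih' = set_integral_padic_scale(1)[OF haar x0 ih]
  have if': "set_integrable M (cball 0 1) (\<lambda>t. f (x * t))"
    by (rule set_integral_padic_scale(1)[OF haar x0 locally_integrable_cball[OF haar li]])
  note iKf = integrable_frac_kernel_mult[OF haar \<alpha> if']
  have iKP: "set_integrable M (cball 0 1) (\<lambda>t. frac_kernel \<alpha> t * P t)"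
    unfolding P_def log_expansion_def by (rule Omega_expansion(1)[OF haar \<alpha> \<beta>])
  have IP: "(LINT t:cball 0 1|M. frac_kernel \<alpha> t * P t) =
      (\<Sum>n\<le>N. expansion_coeff M a \<alpha> \<beta> \<gamma> n * ln X powr (\<gamma> - real n))"
    unfolding P_def log_expansion_def expansion_coeff_def by (rule Omega_expansion(2)[OF haar \<alpha> \<beta>])
  have Ih: "(LINT t:cball 0 1|M. h (x * t)) \<le> inverse X * ((LINT y:cball 0 R0|M. f y) + Y\<^sup>2)"
  proof -
    have "X * (LINT t:cball 0 1|M. h (x * t)) = (LINT y:cball 0 X|M. h y)"
      unfolding X_def by (rule set_integral_padic_scale(2)[OF haar x0 ih, symmetric])
    also have "\<dots> = (LINT y:cball 0 Y|M. f y)"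
      unfolding set_lebesgue_integral_def hY ..
    also have "\<dots> \<le> (LINT y:cball 0 R0|M. f y) + Y\<^sup>2"
      by (rule set_integral_cball_le[OF haar li f0 fR Y(1)])
    finally show ?thesis using X1 by (simp add: field_simps)
  qed
  have int1: "integrable M (\<lambda>t. indicator (cball 0 1) t *\<^sub>R (X powr \<beta> * (frac_kernel \<alpha> t * f (x * t)) - frac_kernel \<alpha> t * P t))"
    using set_integral_diff(1)[OF set_integrable_mult_right[OF iKf] iKP] by (simp add: set_integrable_def)
  have int2: "integrable M (\<lambda>t. indicator (cball 0 1) t *\<^sub>R (X powr \<beta> * h (x * t) + E * H t))"
    using set_integral_add(1)[OF set_integrable_mult_right[OF ih'] set_integrable_mult_right[OF iH]]
    by (simp add: set_integrable_def)
  have "X powr \<beta> * (LINT t:cball 0 1|M. frac_kernel \<alpha> t * f (x * t)) - (LINT t:cball 0 1|M. frac_kernel \<alpha> t * P t) =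
      (LINT t:cball 0 1|M. X powr \<beta> * (frac_kernel \<alpha> t * f (x * t)) - frac_kernel \<alpha> t * P t)"
    by (subst set_integral_diff(2)[OF set_integrable_mult_right[OF iKf] iKP]) simp
  also have "\<bar>\<dots>\<bar> \<le> (\<integral>t. norm (indicator (cball 0 1) t *\<^sub>R (X powr \<beta> * (frac_kernel \<alpha> t * f (x * t)) - frac_kernel \<alpha> t * P t)) \<partial>M)"
    unfolding set_lebesgue_integral_def real_norm_def[symmetric] by (rule integral_norm_bound)
  also have "\<dots> \<le> (LINT t:cball 0 1|M. X powr \<beta> * h (x * t) + E * H t)"
    unfolding set_lebesgue_integral_def
  proof (rule integral_mono[OF integrable_norm[OF int1] int2])
    fix t
    show "norm (indicator (cball 0 1) t *\<^sub>R (X powr \<beta> * (frac_kernel \<alpha> t * f (x * t)) - frac_kernel \<alpha> t * P t))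
        \<le> indicator (cball 0 1) t *\<^sub>R (X powr \<beta> * h (x * t) + E * H t)"
    proof (cases "padic_norm t \<le> 1")
      case True
      have "\<bar>X powr \<beta> * (frac_kernel \<alpha> t * f (x * t)) - frac_kernel \<alpha> t * P t\<bar> =
          \<bar>frac_kernel \<alpha> t\<bar> * \<bar>X powr \<beta> * f (x * t) - P t\<bar>"
        by (simp add: algebra_simps flip: abs_mult)
      also have "\<dots> \<le> 1 * (X powr \<beta> * h (x * t) + E * H t)"
        using err[OF True] unfolding X_def[symmetric] Y_def[symmetric] h_def[symmetric] H_def[symmetric] P_def[symmetric]
        by (intro mult_mono abs_frac_kernel_le_1 \<alpha> True) auto
      finally show ?thesis using True by (simp add: padic_cball_0)
    qed (simp add: padic_cball_0)
  qed
  also have "\<dots> = X powr \<beta> * (LINT t:cball 0 1|M. h (x * t)) + E * (LINT t:cball 0 1|M. H t)"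
    by (subst set_integral_add(2)[OF set_integrable_mult_right[OF ih'] set_integrable_mult_right[OF iH]]) simp
  also have "X powr \<beta> * (LINT t:cball 0 1|M. h (x * t)) \<le> X powr \<beta> * (inverse X * ((LINT y:cball 0 R0|M. f y) + Y\<^sup>2))"
    by (intro mult_left_mono Ih) simp
  also have "\<dots> = X powr (\<beta> - 1) * ((LINT y:cball 0 R0|M. f y) + X powr (2 * (1 - r)))"
  proof -
    have "Y\<^sup>2 = X powr (2 * (1 - r))"
      by (simp only: Y_def power2_eq_square mult_2 flip: powr_add)
    moreover have "X powr (\<beta> - 1) = X powr \<beta> * inverse X"
      using X1 by (simp add: powr_diff divide_inverse)
    ultimately show ?thesis by (simp only: mult.assoc)
  qed
  finally show ?thesis
    unfolding IP X_def H_def by simp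
qed

end

theorem theorem3:
  fixes M :: "'p::prime_card padic measure"
    and f :: "'p padic \<Rightarrow> real"
    and a :: "nat \<Rightarrow> real"
    and \<alpha> \<beta> \<gamma> :: real
  assumes "normalized_Haar M"
    and "\<alpha> > 1" and "0 \<le> \<beta>" and "\<beta> < 1" and "\<gamma> \<ge> 0"
    and "\<And>x. f x \<ge> 0"
    and "locally_integrable M f"
    and "\<And>N. (\<lambda>x. f x - padic_norm x powr (- \<beta>) *
                     (\<Sum>n\<le>N. a n * ln (padic_norm x) powr (\<gamma> - real n)))
           \<in> o[padic_at_infinity](\<lambda>x. padic_norm x powr (- \<beta>) * ln (padic_norm x) powr (\<gamma> - real N))"
  shows "\<forall>N. (\<lambda>x. frac_integral M \<alpha> f x -
                   frac_const CARD('p) \<alpha> * padic_norm x powr (\<alpha> - \<beta>) *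
                     (\<Sum>n\<le>N. expansion_coeff M a \<alpha> \<beta> \<gamma> n * ln (padic_norm x) powr (\<gamma> - real n)))
           \<in> o[padic_at_infinity](\<lambda>x. padic_norm x powr (\<alpha> - \<beta>) * ln (padic_norm x) powr (\<gamma> - real N))"
proof (intro allI landau_o.smallI)
  fix N and c :: real assume "c > 0"
  \<comment> \<open>With the cut at |x|^\<delta> the contribution of small arguments has order
    |x|^(\<beta>-1+2\<delta>) = |x|^(-2\<delta>), because 1 - \<beta> = 4\<delta>.\<close>
  define \<delta> where "\<delta> = (1 - \<beta>) / 4"
  define r where "r = 1 - \<delta>"
  have \<delta>: "\<delta> > 0" "1 - \<beta> = 4 * \<delta>" using assms by (auto simp: \<delta>_def)
  have r: "0 < r" "r < 1" using assms by (auto simp: r_def \<delta>_def field_simps)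
  obtain C where C: "C \<ge> 0" "\<And>L l. L \<ge> 1 \<Longrightarrow> l \<le> 0 \<Longrightarrow>
      \<bar>(if - r * L \<le> l then \<Sum>n\<le>N. a n * (L + l) powr (\<gamma> - real n) else 0) - log_expansion a \<gamma> N L l\<bar>
      \<le> C * (1 + \<bar>l\<bar>) ^ Suc N * L powr (\<gamma> - real N - 1)"
    using log_expansion_bound[OF r, where N = N and a = a and \<gamma> = \<gamma>] by blast
  obtain R0 where R0: "\<And>x. padic_norm x \<ge> R0 \<Longrightarrow> f x \<le> padic_norm x"
    using padic_expansion_le_norm[of \<beta> f "a 0" \<gamma>] assms(3) assms(8)[of 0] by auto
  define I where "I = (LINT y:cball 0 R0|M. f y)"
  define J where "J = (LINT t:cball 0 1|M. padic_norm t powr (- \<beta>) * (1 + \<bar>ln (padic_norm t)\<bar>) ^ Suc N)"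
  define D where "D = (1 - r) powr (- \<bar>\<gamma> - real N\<bar>)"
  have D: "D > 0" using r by (simp add: D_def)
  have J: "J \<ge> 0" unfolding J_def set_lebesgue_integral_def by (intro Bochner_Integration.integral_nonneg) simp
  have I: "I \<ge> 0" unfolding I_def set_lebesgue_integral_def using assms(6) by (intro Bochner_Integration.integral_nonneg) simp
  define k where "k = \<bar>frac_const CARD('p) \<alpha>\<bar> + 1"
  have k: "k > 0" by (simp add: k_def)
  \<comment> \<open>Three errors of size at most \<eta> times the gauge will be added: small
    arguments, the error \<epsilon> of the hypothesis, and the Taylor remainder. The factor
    \<open>k\<close> absorbs the constant of the operator.\<close>
  define \<eta> where "\<eta> = c / (3 * k)"
  have \<eta>: "\<eta> > 0" using \<open>c > 0\<close> k by (simp add: \<eta>_def)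
  \<comment> \<open>This makes \<epsilon> D J at most \<eta>; \<open>J + 1\<close> keeps the
    denominator positive.\<close>
  define \<epsilon> where "\<epsilon> = \<eta> / (D * (J + 1))"
  have \<epsilon>: "\<epsilon> > 0" using \<eta> D J by (simp add: \<epsilon>_def)
  have "\<forall>\<^sub>F x in padic_at_infinity.
      norm (f x - padic_norm x powr (- \<beta>) * (\<Sum>n\<le>N. a n * ln (padic_norm x) powr (\<gamma> - real n)))
      \<le> \<epsilon> * norm (padic_norm x powr (- \<beta>) * ln (padic_norm x) powr (\<gamma> - real N))"
    by (rule landau_o.smallD[OF assms(8) \<epsilon>])
  then obtain R where R: "\<And>y. padic_norm y \<ge> R \<Longrightarrow>
      \<bar>f y - padic_norm y powr (- \<beta>) * (\<Sum>n\<le>N. a n * ln (padic_norm y) powr (\<gamma> - real n))\<bar>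
        \<le> \<epsilon> * (padic_norm y powr (- \<beta>) * ln (padic_norm y) powr (\<gamma> - real N))"
    unfolding eventually_padic_at_infinity by auto
  have "\<forall>\<^sub>F X in at_top. ln X \<ge> 1 \<and> X > 1 \<and> X powr \<delta> \<ge> R \<and> (C * J) / ln X \<le> \<eta> \<and>
      (I + 1) * X powr (- (2 * \<delta>)) \<le> \<eta> * ln X powr (\<gamma> - real N)"
    using \<eta> \<delta> by (intro eventually_powr_bounds) auto
  then have "\<forall>\<^sub>F x :: 'p padic in padic_at_infinity. ln (padic_norm x) \<ge> 1 \<and> padic_norm x > 1 \<and>
      padic_norm x powr \<delta> \<ge> R \<and> (C * J) / ln (padic_norm x) \<le> \<eta> \<and>
      (I + 1) * padic_norm x powr (- (2 * \<delta>)) \<le> \<eta> * ln (padic_norm x) powr (\<gamma> - real N)"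
    unfolding padic_at_infinity_def by (rule eventually_filtercomapI)
  then show "\<forall>\<^sub>F x in padic_at_infinity.
      norm (frac_integral M \<alpha> f x - frac_const CARD('p) \<alpha> * padic_norm x powr (\<alpha> - \<beta>) *
        (\<Sum>n\<le>N. expansion_coeff M a \<alpha> \<beta> \<gamma> n * ln (padic_norm x) powr (\<gamma> - real n)))
      \<le> c * norm (padic_norm x powr (\<alpha> - \<beta>) * ln (padic_norm x) powr (\<gamma> - real N))"
  proof eventually_elim
    case (elim x)
    define X where "X = padic_norm x"
    define L where "L = ln X"
    define E where "E = L powr (\<gamma> - real N) * (\<epsilon> * D + C / L)"
    define S where "S = (\<Sum>n\<le>N. expansion_coeff M a \<alpha> \<beta> \<gamma> n * L powr (\<gamma> - real n))"
    define F where "F = (LINT t:cball 0 1|M. frac_kernel \<alpha> t * f (x * t))"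
    have X: "X > 1" and L: "L \<ge> 1" using elim by (simp_all add: X_def L_def)
    have x0: "x \<noteq> 0" using elim by auto
    have "\<bar>X powr \<beta> * F - S\<bar> \<le> X powr (\<beta> - 1) * (I + X powr (2 * (1 - r))) + E * J"
      unfolding X_def F_def S_def L_def I_def J_def
    proof (rule scaled_integral_error[OF assms(1,7,2,4) r _ _ assms(6) R0])
      show "1 \<le> ln (padic_norm x)" "1 < padic_norm x" using elim by simp_all
      fix t :: "'p padic" assume "padic_norm t \<le> 1"
      then show "\<bar>padic_norm x powr \<beta> * f (x * t) - padic_norm t powr (- \<beta>) * log_expansion a \<gamma> N (ln (padic_norm x)) (ln (padic_norm t))\<bar>
    \<le> padic_norm x powr \<beta> * (indicator (cball 0 (padic_norm x powr (1 - r))) (x * t) * f (x * t)) +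
      E * (padic_norm t powr (- \<beta>) * (1 + \<bar>ln (padic_norm t)\<bar>) ^ Suc N)"
        unfolding E_def L_def X_def D_def using elim \<epsilon>
        by (intro scaled_expansion_error[OF r _ assms(6) R _ _ C]) (auto simp: r_def)
    qed
    also have "\<dots> \<le> 3 * \<eta> * L powr (\<gamma> - real N)"
    proof -
      \<comment> \<open>Here X^(2\<delta>) \<ge> 1 allows the constant \<open>I\<close> to be merged
        with the growing term.\<close>
      have "I + X powr (2 * (1 - r)) \<le> (I + 1) * X powr (2 * \<delta>)"
        using I X \<delta> ge_one_powr_ge_zero[of X "2 * \<delta>"] mult_left_mono[of 1 "X powr (2 * \<delta>)" I]
        by (simp add: r_def algebra_simps)
      then have "X powr (\<beta> - 1) * (I + X powr (2 * (1 - r))) \<le> X powr (\<beta> - 1) * ((I + 1) * X powr (2 * \<delta>))"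
        by (intro mult_left_mono) auto
      also have "\<dots> = (I + 1) * X powr (- (2 * \<delta>))"
      proof -
        have "\<beta> - 1 + 2 * \<delta> = - (2 * \<delta>)" using \<delta> by simp
        then show ?thesis by (metis mult.left_commute powr_add)
      qed
      also have "\<dots> \<le> \<eta> * L powr (\<gamma> - real N)" using elim by (simp add: X_def L_def)
      finally have 1: "X powr (\<beta> - 1) * (I + X powr (2 * (1 - r))) \<le> \<eta> * L powr (\<gamma> - real N)" .
      have "\<epsilon> * D * J \<le> \<epsilon> * D * (J + 1)" using \<epsilon> D by (intro mult_left_mono) auto
      also have "\<dots> = \<eta>" using D J by (simp add: \<epsilon>_def)
      finally have "(\<epsilon> * D + C / L) * J \<le> 2 * \<eta>"
        using elim by (simp add: algebra_simps L_def X_def)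
      then have "L powr (\<gamma> - real N) * ((\<epsilon> * D + C / L) * J) \<le> L powr (\<gamma> - real N) * (2 * \<eta>)"
        by (rule mult_left_mono) simp
      then have "E * J \<le> 2 * \<eta> * L powr (\<gamma> - real N)" by (simp add: E_def mult_ac)
      with 1 show ?thesis by simp
    qed
    finally have main: "\<bar>X powr \<beta> * F - S\<bar> \<le> 3 * \<eta> * L powr (\<gamma> - real N)" .
    \<comment> \<open>Splitting |x|^\<alpha> into |x|^(\<alpha>-\<beta>) |x|^\<beta> leaves exactly
      the scaled difference already estimated.\<close>
    have "frac_integral M \<alpha> f x - frac_const CARD('p) \<alpha> * X powr (\<alpha> - \<beta>) * S =
        frac_const CARD('p) \<alpha> * X powr (\<alpha> - \<beta>) * (X powr \<beta> * F - S)"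
    proof -
      have "X powr \<alpha> = X powr (\<alpha> - \<beta>) * X powr \<beta>" by (simp flip: powr_add)
      then show ?thesis
        using frac_integral_eq[OF assms(1,7) x0] by (simp add: X_def F_def algebra_simps)
    qed
    then have "norm (frac_integral M \<alpha> f x - frac_const CARD('p) \<alpha> * X powr (\<alpha> - \<beta>) * S) =
        \<bar>frac_const CARD('p) \<alpha>\<bar> * X powr (\<alpha> - \<beta>) * \<bar>X powr \<beta> * F - S\<bar>"
      by (simp add: abs_mult)
    also have "\<dots> \<le> k * X powr (\<alpha> - \<beta>) * (3 * \<eta> * L powr (\<gamma> - real N))"
      by (intro mult_mono main) (auto simp: k_def)
    also have "\<dots> = c * norm (X powr (\<alpha> - \<beta>) * L powr (\<gamma> - real N))"
      using k by (simp add: \<eta>_def abs_mult)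
    finally show ?case by (simp add: X_def S_def L_def)
  qed
qed

end
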